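(* Let $d\ge 1$ be an integer, let $\alpha>d$, and let $(\xi(z)\colon z\in\mathbb{Z}^d)$ be independent identically distributed random variables with $\mathrm{Prob}(\xi(z)\le x)=1-x^{-\alpha}$ for $x\ge 1$. Let $u\colon(0,\infty)\times\mathbb{Z}^d\to[0,\infty)$ be the (almost surely unique) nonnegative solution of the parabolic Anderson problem $$\partial_t u(t,z)=\Delta u(t,z)+\xi(z)u(t,z),\quad (t,z)\in(0,\infty)\times\mathbb{Z}^d,\qquad u(0,z)=\mathbf{1}_0(z),\quad z\in\mathbb{Z}^d,$$ and let $U(t)=\sum_{z\in\mathbb{Z}^d}u(t,z)$. Then there exists a process $(Z_t\colon t>0)$ with values in $\mathbb{Z}^d$ (defined on the probability space of $\xi$) such that $$\lim_{t\to\infty}\frac{u(t,Z_t)}{U(t)}=1\qquad\text{in probability.}$$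
   Context: $\Delta$ is the discrete Laplacian $(\Delta f)(z)=\sum_{y\sim z}[f(y)-f(z)]$ for $f\colon\mathbb{Z}^d\to\mathbb{R}$, where $y\sim z$ means that $y,z\in\mathbb{Z}^d$ are nearest neighbours; $\mathbf{1}_0(z)=1$ if $z=0$ and $0$ otherwise. For $\alpha>d$ it is known that, almost surely, the problem has a unique nonnegative solution, given by the Feynman–Kac formula $u(t,z)=\mathbb{E}_0\big[\exp\{\int_0^t\xi(X_s)\,\mathrm{d}s\}\mathbf{1}\{X_t=z\}\big]$, where under $\mathbb{P}_0$ (expectation $\mathbb{E}_0$) $(X_s\colon s\ge0)$ is the continuous-time simple random walk on $\mathbb{Z}^d$ with generator $\Delta$ started at the origin, independent of $\xi$ (the expectation is for fixed $\xi$). $\mathrm{Prob}$ denotes the law of $\xi$, and convergence in probability is with respect to it. *)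

theory Defs
  imports "HOL-Probability.Probability"
begin

definition lattice_neighbours :: "int ^ 'd \<Rightarrow> (int ^ 'd::finite) set" where
  "lattice_neighbours z = {y. (\<Sum>i\<in>UNIV. \<bar>y $ i - z $ i\<bar>) = 1}"

text \<open>Finiteness matters because a sum over an infinite set would silently be zero.\<close>

lemma finite_lattice_neighbours:
  fixes z :: "int ^ 'd::finite"
  shows "finite (lattice_neighbours z)"
proof -
  let ?F = "PiE (UNIV :: 'd set) (\<lambda>i. {z $ i - 1..z $ i + 1})"
  have "vec_nth y \<in> ?F" if y: "y \<in> lattice_neighbours z" for y
  proof -
    have "z $ i - 1 \<le> y $ i \<and> y $ i \<le> z $ i + 1" for i
    proof -
      have "\<bar>y $ i - z $ i\<bar> \<le> (\<Sum>j\<in>UNIV. \<bar>y $ j - z $ j\<bar>)"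
        by (rule member_le_sum) auto
      also have "\<dots> = 1"
        using y by (simp add: lattice_neighbours_def)
      finally show ?thesis
        by linarith
    qed
    then show ?thesis
      by (simp add: PiE_iff)
  qed
  then have "vec_nth ` lattice_neighbours z \<subseteq> ?F"
    by blast
  moreover have "finite ?F"
    by (intro finite_PiE) simp_all
  ultimately have "finite (vec_nth ` lattice_neighbours z)"
    by (rule finite_subset)
  moreover have "inj_on vec_nth (lattice_neighbours z)"
    by (simp add: inj_on_def vec_nth_inject)
  ultimately show ?thesis
    by (rule finite_imageD)
qed

definition discrete_laplacian :: "(int ^ 'd::finite \<Rightarrow> real) \<Rightarrow> int ^ 'd \<Rightarrow> real" where
  "discrete_laplacian f z = (\<Sum>y\<in>lattice_neighbours z. f y - f z)"

text \<open>
  A solution is only constrained at times \<open>t > 0\<close>, so the initial condition is the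
  pointwise limit as \<open>t\<close> decreases to \<open>0\<close>.
\<close>

definition nonneg_pam_solution ::
  "(int ^ 'd::finite \<Rightarrow> real) \<Rightarrow> (real \<Rightarrow> int ^ 'd \<Rightarrow> real) \<Rightarrow> bool" where
  "nonneg_pam_solution V u \<longleftrightarrow>
     (\<forall>t>0. \<forall>z. u t z \<ge> 0) \<and>
     (\<forall>t>0. \<forall>z. ((\<lambda>s. u s z) has_real_derivative
        (discrete_laplacian (u t) z + V z * u t z)) (at t)) \<and>
     (\<forall>z. ((\<lambda>t. u t z) \<longlongrightarrow> (if z = 0 then 1 else 0)) (at_right 0))"

text \<open>
  If the nonnegative family \<open>f\<close> has infinite total mass, then \<open>total_mass f = 0\<close>, and
  every quotient \<open>f z / total_mass f\<close> is \<open>0\<close>, which is also its value under the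
  convention that a finite number divided by infinity is zero.
\<close>

definition total_mass :: "(int ^ 'd::finite \<Rightarrow> real) \<Rightarrow> real" where
  "total_mass f = (\<Sum>\<^sub>\<infinity>z. f z)"

text \<open>
  Convergence in probability of a family \<open>X\<close> to the constant \<open>c\<close> along the filter \<open>F\<close>.
  A solution that is only prescribed almost surely need not be measurable with respect to
  \<open>M\<close> unless \<open>M\<close> is complete, so the deviation events are measured by the outer measure.
  For random variables this is the usual notion, as the lemma below shows.
\<close>

definition converges_in_prob ::
  "'w measure \<Rightarrow> ('t \<Rightarrow> 'w \<Rightarrow> real) \<Rightarrow> real \<Rightarrow> 't filter \<Rightarrow> bool" where
  "converges_in_prob M X c F \<longleftrightarrow>
     (\<forall>\<epsilon>>0. ((\<lambda>t. outer_measure_of M {\<omega> \<in> space M. \<bar>X t \<omega> - c\<bar> > \<epsilon>}) \<longlongrightarrow> 0) F)"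

lemma converges_in_prob_iff:
  assumes "prob_space M" and [measurable]: "\<And>t. X t \<in> borel_measurable M"
  shows "converges_in_prob M X c F \<longleftrightarrow>
    (\<forall>\<epsilon>>0. ((\<lambda>t. measure M {\<omega> \<in> space M. \<bar>X t \<omega> - c\<bar> > \<epsilon>}) \<longlongrightarrow> 0) F)"
proof -
  interpret prob_space M by fact
  show ?thesis
    by (simp add: converges_in_prob_def emeasure_eq_measure
        flip: ennreal_0)
qed

end

theory Submission
  imports Defs "HOL-Real_Asymp.Real_Asymp"
begin

text \<open>
  A path that carries mass to a site \<open>A\<close> by time \<open>t\<close> has to make \<open>\<bar>A\<bar>\<close> jumps quickly and can
  then stay at \<open>A\<close>. When the relevant values of the potential are of order \<open>a\<close>, each jump costs
  a factor of about \<open>1 / a\<close>, so this strategy contributes roughly \<open>exp (t * \<Phi> A)\<close>, where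
  \<open>\<Phi> z = \<xi> z - \<kappa> * \<bar>z\<bar>\<close>, \<open>\<kappa> = ln a / t\<close>, and \<open>\<bar>z\<bar>\<close> is the l1 norm. The height \<open>a\<close> is determined by
  the time \<open>t\<close> through \<open>\<kappa> = a powr - ((\<alpha> - d) / d)\<close>: for this choice the sites with \<open>\<bar>z\<bar>\<close> of order
  \<open>r = a / \<kappa>\<close> number about \<open>r powr d = a powr \<alpha>\<close>, so that on average a bounded number of them carries
  values of order \<open>a\<close>, and both terms of \<open>\<Phi>\<close> have order \<open>a\<close> there. The process \<open>Z t\<close> is the maximiser of \<open>\<Phi>\<close>.

  \<^bold>\<open>The deterministic part.\<close> Suppose that \<open>\<Phi> A\<close> exceeds all other values of \<open>\<Phi>\<close> by a fixed multiple
  of \<open>a\<close>. Then \<open>A\<close> carries almost all of the mass, because the gap gains a multiple of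
  \<open>t * a = r * ln a\<close> in the exponent and the errors that it has to absorb are either a smaller multiple
  of \<open>t * a\<close> or of order \<open>t + r\<close>.
  The lower bound \<open>peak_lower_bound\<close> implements the strategy above. The
  upper bound is a comparison with explicit supersolutions of the equation. Paths are sorted by
  the largest distance \<open>k\<close> from the origin that they reach: if \<open>\<mu> k\<close> exceeds the potential in the
  ball of radius \<open>k\<close> by \<open>\<eta>\<close>, then these paths contribute at most \<open>exp (\<mu> k * t) * \<theta> ^ k\<close> with
  \<open>\<theta>\<close> of order \<open>1 / \<eta>\<close>, and the sum over \<open>k\<close> is again a supersolution
  (\<open>range_sum_super\<close>). Paths that meet \<open>A\<close> but do not end there are controlled by
  \<open>\<theta> ^ \<bar>z - A\<bar>\<close> times the mass at \<open>A\<close>, because in a ball slightly larger than \<open>\<bar>A\<bar>\<close> the potential is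
  much smaller than at \<open>A\<close> (\<open>local_bound\<close>), while outside that ball every path is
  already paid for by its range. Since the supersolutions are compared in finite balls, what the
  solution brings in from the boundary must vanish as the balls grow; this holds for every
  nonnegative solution, because a large value far away would have made the solution large
  at the origin at a later time (\<open>a_priori_bound\<close>, \<open>barrier_vanishes\<close>).
  The outcome is the lemma \<open>concentration\<close>.

  \<^bold>\<open>The probabilistic part.\<close> It remains to find the gap with high probability, uniformly in large
  \<open>a\<close>. A union bound over dyadic shells shows \<open>\<xi> z \<le> K * a + \<kappa> / 2 * \<bar>z\<bar>\<close> for all \<open>z\<close>; this uses
  \<open>\<alpha> > d\<close> and confines the relevant sites to a ball of radius of order \<open>r\<close>. Independence in a small ball
  gives \<open>\<Phi> z > c * a\<close> for some \<open>z\<close>. Finally two of the relevant sites rarely have values of \<open>\<Phi>\<close>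
  within \<open>\<delta> * a\<close> of each other, since the Pareto law has a bounded density at scale \<open>a\<close> and the values are
  independent. The lemma \<open>isolated_peak\<close> combines the three events.
\<close>

section \<open>Lattice geometry in the l1 norm\<close>

definition l1 :: "int ^ 'd::finite \<Rightarrow> nat" where
  "l1 z = nat (\<Sum>i\<in>UNIV. \<bar>z $ i\<bar>)"

lemma int_l1: "int (l1 z) = (\<Sum>i\<in>UNIV. \<bar>z $ i\<bar>)"
  by (simp add: l1_def sum_nonneg)

lemma l1_eq_0_iff [simp]: "l1 z = 0 \<longleftrightarrow> z = 0"
proof -
  have "l1 z = 0 \<longleftrightarrow> (\<Sum>i\<in>UNIV. \<bar>z $ i\<bar>) = 0"
    using int_l1[of z] by linarith
  then show ?thesis
    by (simp add: sum_nonneg_eq_0_iff vec_eq_iff)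
qed

lemma l1_0 [simp]: "l1 0 = 0"
  by (simp only: l1_eq_0_iff)

lemma l1_triangle: "l1 (x + y) \<le> l1 x + l1 y"
proof -
  have "int (l1 (x + y)) \<le> int (l1 x) + int (l1 y)"
    unfolding int_l1 sum.distrib[symmetric] by (intro sum_mono) auto
  then show ?thesis by linarith
qed

lemma l1_minus_commute: "l1 (x - y) = l1 (y - x)"
  by (simp add: l1_def abs_minus_commute)

lemma lattice_neighbours_iff: "y \<in> lattice_neighbours z \<longleftrightarrow> l1 (y - z) = 1"
  using int_l1[of "y - z"] unfolding lattice_neighbours_def by auto

lemma l1_neighbour:
  assumes "y \<in> lattice_neighbours z"
  shows "l1 (y - x) \<le> Suc (l1 (z - x))" "l1 (z - x) \<le> Suc (l1 (y - x))"
  using assms l1_triangle[of "y - z" "z - x"] l1_triangle[of "z - y" "y - x"]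
  by (auto simp: lattice_neighbours_iff l1_minus_commute[of z y])

lemma l1_neighbour0:
  assumes "y \<in> lattice_neighbours z"
  shows "l1 y \<le> Suc (l1 z)" "l1 z \<le> Suc (l1 y)"
  using l1_neighbour[OF assms, of 0] by auto

text \<open>
  Geodesics exist: the norm of \<open>z - x\<close> can be lowered by a step in any coordinate in which \<open>z\<close> and
  \<open>x\<close> differ.
\<close>

lemma neighbour_towards:
  assumes "l1 (z - x) = Suc n"
  obtains y where "y \<in> lattice_neighbours z" "l1 (y - x) = n"
proof -
  have "z \<noteq> x" using assms by auto
  then obtain i where i: "z $ i \<noteq> x $ i" by (auto simp: vec_eq_iff)
  define y where "y = (\<chi> j. if j = i then z $ i - sgn (z $ i - x $ i) else z $ j)"
  have "int (l1 (y - z)) = (\<Sum>j\<in>UNIV. if j = i then 1 else 0)"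
    unfolding int_l1 using i by (intro sum.cong) (auto simp: y_def sgn_if)
  then have 1: "y \<in> lattice_neighbours z" by (simp add: lattice_neighbours_iff)
  have "int (l1 (z - x)) = (\<Sum>j\<in>UNIV. \<bar>(y - x) $ j\<bar> + (if j = i then 1 else 0))"
    unfolding int_l1 using i by (intro sum.cong) (auto simp: y_def sgn_if)
  also have "\<dots> = int (l1 (y - x)) + 1"
    by (simp add: sum.distrib int_l1)
  finally have 2: "l1 (y - x) = n" using assms by linarith
  show thesis using that 1 2 by blast
qed

lemma card_lattice_neighbours_le:
  fixes z :: "int ^ 'd::finite"
  shows "real (card (lattice_neighbours z)) \<le> 2 * real CARD('d)"
proof -
  have "lattice_neighbours z \<subseteq> (\<lambda>(i, s). z + axis i s) ` (UNIV \<times> {1, -1})"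
  proof
    fix y assume y: "y \<in> lattice_neighbours z"
    then have "l1 (y - z) = Suc 0" by (simp add: lattice_neighbours_iff)
    then have "y \<noteq> z" by auto
    then obtain i where i: "y $ i \<noteq> z $ i" by (auto simp: vec_eq_iff)
    have s: "(\<Sum>j\<in>UNIV. \<bar>(y - z) $ j\<bar>) = 1" using y by (simp add: lattice_neighbours_def)
    have "(\<Sum>j\<in>UNIV. \<bar>(y - z) $ j\<bar>) = \<bar>(y - z) $ i\<bar> + (\<Sum>j\<in>UNIV - {i}. \<bar>(y - z) $ j\<bar>)"
      by (rule sum.remove) auto
    moreover have "(\<Sum>j\<in>UNIV - {i}. \<bar>(y - z) $ j\<bar>) \<ge> 0" by (intro sum_nonneg) auto
    moreover have "\<bar>(y - z) $ i\<bar> \<ge> 1" using i by auto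
    ultimately have 1: "\<bar>(y - z) $ i\<bar> = 1" and "(\<Sum>j\<in>UNIV - {i}. \<bar>(y - z) $ j\<bar>) = 0"
      using s by linarith+
    then have "\<forall>j\<in>UNIV - {i}. \<bar>(y - z) $ j\<bar> = 0" by (subst (asm) sum_nonneg_eq_0_iff) auto
    then have "y = z + axis i (y $ i - z $ i)" by (auto simp: vec_eq_iff axis_def)
    moreover have "y $ i - z $ i \<in> {1, -1}" using 1 by auto
    ultimately show "y \<in> (\<lambda>(i, s). z + axis i s) ` (UNIV \<times> {1, -1})"
      by (intro image_eqI[of _ _ "(i, y $ i - z $ i)"]) auto
  qed
  then have "card (lattice_neighbours z) \<le> card ((\<lambda>(i, s). z + axis i s) ` ((UNIV::'d set) \<times> {1, -1::int}))"
    by (intro card_mono) auto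
  also have "\<dots> \<le> card ((UNIV::'d set) \<times> {1, -1::int})" by (intro card_image_le) auto
  also have "\<dots> = 2 * CARD('d)" by (simp add: card_cartesian_product)
  finally show ?thesis by (simp flip: of_nat_mult)
qed

text \<open>
  Following geodesics, each sphere is contained in the neighbourhood of the previous one. The
  exponential bound is crude, but it is what a geometric weight with small ratio needs.
\<close>

lemma card_l1_sphere_le:
  fixes x :: "int ^ 'd::finite"
  shows "finite {z. l1 (z - x) = n}" (is "?F n")
    and "real (card {z. l1 (z - x) = n}) \<le> (2 * real CARD('d)) ^ n" (is "?C n")
proof -
  have "?F n \<and> ?C n"
  proof (induction n)
    case 0 then show ?case by simp
  next
    case (Suc n)
    let ?S = "\<lambda>n. {z. l1 (z - x) = n}"
    have sub: "?S (Suc n) \<subseteq> (\<Union>y\<in>?S n. lattice_neighbours y)"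
    proof
      fix z assume "z \<in> ?S (Suc n)"
      then obtain y where "y \<in> lattice_neighbours z" "l1 (y - x) = n"
        using neighbour_towards[of z x n] by auto
      then show "z \<in> (\<Union>y\<in>?S n. lattice_neighbours y)"
        by (auto simp: lattice_neighbours_iff l1_minus_commute[of z])
    qed
    have fin: "finite (\<Union>y\<in>?S n. lattice_neighbours y)"
      using Suc finite_lattice_neighbours by auto
    have "card (?S (Suc n)) \<le> card (\<Union>y\<in>?S n. lattice_neighbours y)"
      by (rule card_mono[OF fin sub])
    also have "\<dots> \<le> (\<Sum>y\<in>?S n. card (lattice_neighbours y))"
      using Suc by (intro card_UN_le) auto
    finally have "real (card (?S (Suc n))) \<le> (\<Sum>y\<in>?S n. real (card (lattice_neighbours y)))"
      by (metis of_nat_mono of_nat_sum)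
    also have "\<dots> \<le> (\<Sum>y\<in>?S n. 2 * real CARD('d))"
      by (intro sum_mono card_lattice_neighbours_le)
    also have "\<dots> = real (card (?S n)) * (2 * real CARD('d))" by simp
    also have "\<dots> \<le> (2 * real CARD('d)) ^ Suc n"
      using Suc by (simp add: mult.commute mult_left_mono)
    finally show ?case using finite_subset[OF sub fin] by blast
  qed
  then show "?F n" "?C n" by auto
qed

lemma finite_l1_ball: "finite {z :: int ^ 'd::finite. l1 z \<le> n}"
proof -
  have "{z :: int ^ 'd. l1 z \<le> n} = (\<Union>k\<le>n. {z. l1 (z - 0) = k})" by auto
  moreover have "finite (\<Union>k\<le>n. {z :: int ^ 'd. l1 (z - 0) = k})"
    by (intro finite_UN_I finite_atMost card_l1_sphere_le)
  ultimately show ?thesis by (simp only:)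
qed

lemma sum_half_powers_le_2: "(\<Sum>k\<in>{j..n}. (1/2::real) ^ (k - j)) \<le> 2"
proof -
  have "(\<Sum>k\<in>{j..n}. (1/2::real) ^ (k - j)) = (\<Sum>k\<in>(\<lambda>k. k - j) ` {j..n}. (1/2) ^ k)"
    by (subst sum.reindex) (auto simp: inj_on_def)
  also have "\<dots> \<le> (\<Sum>k. (1/2) ^ k)"
    by (intro sum_le_suminf) (auto intro!: summable_geometric)
  also have "\<dots> = 2" by (simp add: suminf_geometric)
  finally show ?thesis .
qed

text \<open>
  Sums of a small geometric weight over any finite set are dominated by their first sphere. The bound
  is independent of the set, so that it passes to infinite sums.
\<close>

lemma sum_l1_power_le:
  fixes x :: "int ^ 'd::finite"
  assumes "finite S" "0 \<le> q" "2 * (2 * real CARD('d)) * q \<le> 1" "\<And>z. z \<in> S \<Longrightarrow> j \<le> l1 (z - x)"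
  shows "(\<Sum>z\<in>S. q ^ l1 (z - x)) \<le> 2 * (2 * real CARD('d) * q) ^ j"
proof -
  let ?D = "2 * real CARD('d)"
  obtain n where n: "\<And>z. z \<in> S \<Longrightarrow> l1 (z - x) \<le> n"
    using finite_nat_set_iff_bounded_le[of "(\<lambda>z. l1 (z - x)) ` S"] assms(1) by auto
  have "(\<Sum>z\<in>S. q ^ l1 (z - x)) = (\<Sum>k\<in>{j..n}. \<Sum>z\<in>{z \<in> S. l1 (z - x) = k}. q ^ l1 (z - x))"
    using assms n by (intro sum.group[symmetric]) auto
  also have "\<dots> \<le> (\<Sum>k\<in>{j..n}. (?D * q) ^ k)"
  proof (rule sum_mono)
    fix k
    have "(\<Sum>z\<in>{z \<in> S. l1 (z - x) = k}. q ^ l1 (z - x)) = real (card {z \<in> S. l1 (z - x) = k}) * q ^ k"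
      by simp
    also have "\<dots> \<le> real (card {z. l1 (z - x) = k}) * q ^ k"
      using assms card_l1_sphere_le(1)[of x k]
      by (intro mult_right_mono) (auto intro!: card_mono)
    also have "\<dots> \<le> ?D ^ k * q ^ k"
      using assms card_l1_sphere_le(2)[of x k] by (intro mult_right_mono) auto
    finally show "(\<Sum>z\<in>{z \<in> S. l1 (z - x) = k}. q ^ l1 (z - x)) \<le> (?D * q) ^ k"
      by (simp add: power_mult_distrib)
  qed
  also have "\<dots> = (\<Sum>k\<in>{j..n}. (?D * q) ^ j * (?D * q) ^ (k - j))"
    by (intro sum.cong) (auto simp flip: power_add)
  also have "\<dots> \<le> (\<Sum>k\<in>{j..n}. (?D * q) ^ j * (1/2) ^ (k - j))"
    using assms by (intro sum_mono mult_left_mono power_mono) auto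
  also have "\<dots> = (?D * q) ^ j * (\<Sum>k\<in>{j..n}. (1/2) ^ (k - j))"
    by (simp add: sum_distrib_left)
  also have "\<dots> \<le> (?D * q) ^ j * 2"
    using assms by (intro mult_left_mono sum_half_powers_le_2) auto
  finally show ?thesis by (simp only: mult.commute)
qed

section \<open>Maximum principle and propagation of mass\<close>

text \<open>
  With the damping \<open>exp (- K * s)\<close>, where \<open>K\<close> exceeds the potential, a negative minimum over time and
  space cannot be attained: the neighbours are not lower, so the function would strictly increase in time
  up to the minimum. The limit at time \<open>0\<close> is added to make the time interval compact.
\<close>

lemma finite_max_principle:
  fixes f f' :: "real \<Rightarrow> int ^ 'd::finite \<Rightarrow> real"
  assumes "finite B"
    and deriv: "\<And>s z. 0 < s \<Longrightarrow> s \<le> T \<Longrightarrow> z \<in> B \<Longrightarrow> ((\<lambda>s. f s z) has_real_derivative f' s z) (at s)"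
    and super: "\<And>s z. 0 < s \<Longrightarrow> s \<le> T \<Longrightarrow> z \<in> B \<Longrightarrow> f' s z \<ge> discrete_laplacian (f s) z + V z * f s z"
    and boundary: "\<And>s z y. 0 < s \<Longrightarrow> s \<le> T \<Longrightarrow> z \<in> B \<Longrightarrow> y \<in> lattice_neighbours z \<Longrightarrow> y \<notin> B \<Longrightarrow> f s y \<ge> 0"
    and initial: "\<And>z. z \<in> B \<Longrightarrow> ((\<lambda>s. f s z) \<longlongrightarrow> l z) (at_right 0)" "\<And>z. z \<in> B \<Longrightarrow> l z \<ge> 0"
    and "0 < s" "s \<le> T" "z \<in> B"
  shows "f s z \<ge> 0"
proof (rule ccontr)
  assume neg: "\<not> f s z \<ge> 0"
  define K where "K = Max (V ` B) + 1"
  have K: "V y < K" if "y \<in> B" for y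
  proof -
    have "V y \<le> Max (V ` B)" using \<open>finite B\<close> that by (intro Max_ge) auto
    then show ?thesis unfolding K_def by linarith
  qed
  define g where "g s z = (if s = 0 then l z else exp (- K * s) * f s z)" for s z
  have cont: "continuous_on {0..T} (\<lambda>s. g s y)" if y: "y \<in> B" for y
  proof (rule continuous_on_eq_continuous_within[THEN iffD2], rule ballI)
    fix x assume x: "x \<in> {0..T}"
    show "continuous (at x within {0..T}) (\<lambda>s. g s y)"
    proof (cases "x = 0")
      case True
      have "((\<lambda>s. exp (- K * s) * f s y) \<longlongrightarrow> exp (- K * 0) * l y) (at_right 0)"
        using initial(1)[OF y] by (intro tendsto_intros)
      then have "((\<lambda>s. exp (- K * s) * f s y) \<longlongrightarrow> l y) (at_right 0)" by simp
      moreover have "\<forall>\<^sub>F s in at_right 0. exp (- K * s) * f s y = g s y"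
        using eventually_at_right_less[of "0::real"] by eventually_elim (simp add: g_def)
      ultimately have "((\<lambda>s. g s y) \<longlongrightarrow> l y) (at_right 0)"
        by (rule Lim_transform_eventually)
      moreover have "at 0 within {0..T} = at_right 0"
        using assms(7,8) by (intro at_within_Icc_at_right) auto
      ultimately show ?thesis using True by (simp add: continuous_within g_def)
    next
      case False
      then have x0: "0 < x" "x \<le> T" using x by auto
      have "isCont (\<lambda>s. exp (- K * s) * f s y) x"
        using DERIV_isCont[OF deriv[OF x0 y]] by (intro continuous_intros)
      moreover have "\<forall>\<^sub>F s in nhds x. exp (- K * s) * f s y = g s y"
        using x0 by (intro eventually_nhds[THEN iffD2] exI[of _ "{0<..}"]) (auto simp: g_def)
      ultimately have "isCont (\<lambda>s. g s y) x" by (simp add: isCont_cong)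
      then show ?thesis by (rule continuous_at_imp_continuous_at_within)
    qed
  qed
  have "\<exists>x\<in>{0..T}. \<forall>s\<in>{0..T}. g x y \<le> g s y" if "y \<in> B" for y
    using continuous_attains_inf[OF _ _ cont[OF that]] assms(7,8) by auto
  then obtain \<tau> where \<tau>: "\<And>y. y \<in> B \<Longrightarrow> \<tau> y \<in> {0..T}"
      "\<And>y s. y \<in> B \<Longrightarrow> s \<in> {0..T} \<Longrightarrow> g (\<tau> y) y \<le> g s y"
    by metis
  obtain x where x: "x \<in> B" "\<And>y. y \<in> B \<Longrightarrow> g (\<tau> x) x \<le> g (\<tau> y) y"
    using ex_min_if_finite[of "(\<lambda>y. g (\<tau> y) y) ` B"] \<open>finite B\<close> \<open>z \<in> B\<close> by (force simp: not_less)
  have min: "g (\<tau> x) x \<le> g s y" if "y \<in> B" "s \<in> {0..T}" for s y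
    using x(2)[OF that(1)] \<tau>(2)[OF that] by linarith
  have "g s z < 0" using neg assms(7) by (auto simp: g_def mult_less_0_iff)
  then have m: "g (\<tau> x) x < 0" using min[of z s] assms(7-9) by auto
  define t where "t = \<tau> x"
  have t: "0 < t" "t \<le> T"
    using \<tau>(1)[OF x(1)] m initial(2)[OF x(1)] unfolding t_def g_def by (auto split: if_splits)
  let ?e = "exp (- K * t)"
  have "((\<lambda>s. exp (- K * s) * f s x) has_real_derivative ?e * (f' t x - K * f t x)) (at t)"
    by (rule derivative_eq_intros deriv[OF t x(1)] refl | simp add: algebra_simps)+
  moreover have "0 < ?e * (f' t x - K * f t x)"
  proof -
    have nb: "f t x \<le> f t y" if "y \<in> lattice_neighbours x" for y
    proof (cases "y \<in> B")
      case True
      then have "?e * f t x \<le> ?e * f t y" using min[OF True, of t] t by (simp add: t_def[symmetric] g_def)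
      then show ?thesis by simp
    next
      case False
      then have "f t y \<ge> 0" using boundary[OF t x(1) that] by simp
      then show ?thesis using m t by (auto simp: t_def[symmetric] g_def mult_less_0_iff)
    qed
    have "discrete_laplacian (f t) x \<ge> 0"
      unfolding discrete_laplacian_def using nb by (intro sum_nonneg) simp
    moreover have "(V x - K) * f t x > 0"
      using m t K[OF x(1)] by (intro mult_neg_neg) (auto simp: t_def[symmetric] g_def mult_less_0_iff)
    ultimately show ?thesis using super[OF t x(1)] by (simp add: algebra_simps)
  qed
  ultimately obtain d where d: "d > 0" "\<And>h. 0 < h \<Longrightarrow> h < d \<Longrightarrow> exp (- K * (t - h)) * f (t - h) x < ?e * f t x"
    using DERIV_pos_inc_left by blast
  define h where "h = min (d/2) (t/2)"
  have h: "0 < h" "h < d" "h < t" using d t by (auto simp: h_def)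
  have "g (t - h) x < g t x" using d(2)[OF h(1,2)] h t by (simp add: g_def)
  then show False using min[OF x(1), of "t - h"] h t by (simp add: t_def[symmetric])
qed

text \<open>
  The constant \<open>D\<close> is the number of neighbours of a site, that is, the total jump rate.
\<close>

locale pam =
  fixes V :: "int ^ 'd::finite \<Rightarrow> real" and u :: "real \<Rightarrow> int ^ 'd \<Rightarrow> real" and D :: real
  assumes sol: "nonneg_pam_solution V u" and V_nonneg: "0 \<le> V z" and D_def: "D = 2 * real CARD('d)"
begin

lemma card_neighbours_le: "real (card (lattice_neighbours (z :: int ^ 'd))) \<le> D"
  unfolding D_def by (rule card_lattice_neighbours_le)

lemma u_nonneg: "0 < s \<Longrightarrow> 0 \<le> u s z"
  using sol unfolding nonneg_pam_solution_def by auto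

lemma u_deriv: "0 < s \<Longrightarrow> ((\<lambda>s. u s z) has_real_derivative discrete_laplacian (u s) z + V z * u s z) (at s)"
  using sol unfolding nonneg_pam_solution_def by auto

lemma u_initial: "((\<lambda>t. u t z) \<longlongrightarrow> (if z = 0 then 1 else 0)) (at_right 0)"
  using sol unfolding nonneg_pam_solution_def by auto

lemma laplacian_ge:
  assumes "0 < s"
  shows "(\<Sum>y\<in>lattice_neighbours z. u s y) - D * u s z \<le> discrete_laplacian (u s) z"
proof -
  have "real (card (lattice_neighbours z)) * u s z \<le> D * u s z"
    by (intro mult_right_mono card_neighbours_le u_nonneg assms)
  then show ?thesis
    by (simp add: discrete_laplacian_def sum_subtractf)
qed

text \<open>
  Dropping the inflow from the neighbours, the mass at \<open>z\<close> grows at least at rate \<open>V z - D\<close>. Read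
  backwards in time, this controls the whole history of the mass at \<open>z\<close> by its final value.
\<close>

lemma growth_at_site:
  assumes "0 < s" "s \<le> t"
  shows "u s z \<le> exp (- (V z - D) * (t - s)) * u t z"
proof -
  let ?w = "\<lambda>s. exp (- (V z - D) * s) * u s z"
  have "?w s \<le> ?w t"
  proof (rule DERIV_nonneg_imp_nondecreasing[OF assms(2)])
    fix x assume "s \<le> x" "x \<le> t"
    then have x: "0 < x" using assms by auto
    have "(?w has_real_derivative exp (- (V z - D) * x) * (discrete_laplacian (u x) z + D * u x z)) (at x)"
      by (rule derivative_eq_intros u_deriv[OF x] refl | simp add: algebra_simps)+
    moreover have "0 \<le> exp (- (V z - D) * x) * (discrete_laplacian (u x) z + D * u x z)"
      using laplacian_ge[OF x, of z] sum_nonneg[of "lattice_neighbours z" "u x"] u_nonneg[OF x] by (intro mult_nonneg_nonneg) auto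
    ultimately show "\<exists>y. (?w has_real_derivative y) (at x) \<and> 0 \<le> y" by blast
  qed
  then have "exp ((V z - D) * s) * ?w s \<le> exp ((V z - D) * s) * ?w t" by (intro mult_left_mono) auto
  moreover have "exp ((V z - D) * s) * ?w s = u s z"
    unfolding mult.assoc[symmetric] exp_add[symmetric] by (simp add: algebra_simps)
  moreover have "exp ((V z - D) * s) * exp (- (V z - D) * t) = exp (- (V z - D) * (t - s))"
    unfolding exp_add[symmetric] by (simp add: algebra_simps)
  ultimately show ?thesis by (simp only: mult.assoc[symmetric])
qed

text \<open>
  Mass travels along a geodesic from \<open>x\<close> to \<open>z\<close>: the contribution of paths that make exactly the \<open>n\<close>
  jumps of that geodesic is the volume \<open>(s - s0) ^ n / fact n\<close> of ordered jump times, damped by the rate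
  \<open>D\<close>.
\<close>

lemma propagation:
  assumes "0 < s0" "s0 \<le> s" "l1 (z - x) = n"
  shows "exp (D * s0) * u s0 x * (s - s0) ^ n / fact n \<le> exp (D * s) * u s z"
  using assms(2,3)
proof (induction n arbitrary: z s)
  case 0
  then have "z = x" by auto
  have "u s0 x \<le> exp (- (V x - D) * (s - s0)) * u s x" by (rule growth_at_site[OF assms(1) 0(1)])
  also have "\<dots> \<le> exp (D * (s - s0)) * u s x"
    using V_nonneg[of x] 0(1) assms(1) by (intro mult_right_mono u_nonneg) (auto intro: mult_right_mono)
  finally have "exp (D * s0) * u s0 x \<le> exp (D * s0) * (exp (D * (s - s0)) * u s x)"
    by (intro mult_left_mono) auto
  then show ?case using \<open>z = x\<close> by (simp add: mult.assoc[symmetric] exp_add[symmetric] algebra_simps)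
next
  case (Suc n)
  obtain y where y: "y \<in> lattice_neighbours z" "l1 (y - x) = n"
    using neighbour_towards[OF Suc.prems(2)] .
  let ?c = "exp (D * s0) * u s0 x"
  let ?w = "\<lambda>s. exp (D * s) * u s z - ?c * (s - s0) ^ Suc n / fact (Suc n)"
  have "?w s0 \<le> ?w s"
  proof (rule DERIV_nonneg_imp_nondecreasing[OF Suc.prems(1)])
    fix r assume r: "s0 \<le> r" "r \<le> s"
    then have r0: "0 < r" using assms by auto
    let ?d = "exp (D * r) * (discrete_laplacian (u r) z + V z * u r z + D * u r z) - ?c * (r - s0) ^ n / fact n"
    have "((\<lambda>s. (s - s0) ^ Suc n / fact (Suc n)) has_real_derivative
        (real (Suc n) * (r - s0) ^ n) / fact (Suc n)) (at r)"
      by (rule DERIV_cdivide) (rule DERIV_cong, rule DERIV_power[where D = 1], auto intro!: derivative_eq_intros)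
    also have "(real (Suc n) * (r - s0) ^ n) / fact (Suc n) = (r - s0) ^ n / fact n"
      by (simp del: of_nat_Suc)
    finally have "((\<lambda>s. (s - s0) ^ Suc n / fact (Suc n)) has_real_derivative (r - s0) ^ n / fact n) (at r)" .
    from DERIV_cmult[OF this, of ?c]
    have *: "((\<lambda>s. ?c * (s - s0) ^ Suc n / fact (Suc n)) has_real_derivative ?c * (r - s0) ^ n / fact n) (at r)"
      by (simp add: algebra_simps)
    have "((\<lambda>s. exp (D * s) * u s z) has_real_derivative
        exp (D * r) * (discrete_laplacian (u r) z + V z * u r z + D * u r z)) (at r)"
      by (rule derivative_eq_intros u_deriv[OF r0] refl | simp add: algebra_simps)+
    from DERIV_diff[OF this *] have "(?w has_real_derivative ?d) (at r)" .
    moreover have "0 \<le> ?d"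
    proof -
      have "?c * (r - s0) ^ n / fact n \<le> exp (D * r) * u r y" using Suc.IH[OF r(1) y(2)] .
      also have "\<dots> \<le> exp (D * r) * (discrete_laplacian (u r) z + V z * u r z + D * u r z)"
        using laplacian_ge[OF r0, of z] member_le_sum[OF y(1), of "u r"] u_nonneg[OF r0]
          finite_lattice_neighbours[of z] mult_nonneg_nonneg[OF V_nonneg u_nonneg[OF r0], of z z] by (intro mult_left_mono) auto
      finally show ?thesis by simp
    qed
    ultimately show "\<exists>y. (?w has_real_derivative y) (at r) \<and> 0 \<le> y" by blast
  qed
  moreover have "0 \<le> exp (D * s0) * u s0 z" using u_nonneg[OF assms(1)] by simp
  ultimately show ?case by simp
qed

text \<open>
  The case of a start at time \<open>0\<close>, where the solution is only known through its limit.
\<close>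

lemma propagation_from_origin:
  assumes "0 < s"
  shows "exp (- D * s) * s ^ l1 z / fact (l1 z) \<le> u s z"
proof -
  let ?n = "l1 z"
  have "((\<lambda>r. exp (D * r) * u r 0 * (s - r) ^ ?n / fact ?n) \<longlongrightarrow> exp (D * 0) * 1 * (s - 0) ^ ?n / fact ?n) (at_right 0)"
    using u_initial[of 0] by (intro tendsto_intros) auto
  moreover have "\<forall>\<^sub>F r in at_right 0. exp (D * r) * u r 0 * (s - r) ^ ?n / fact ?n \<le> exp (D * s) * u s z"
    using eventually_at_right_real[OF assms] by eventually_elim (use propagation[of _ s z 0] in auto)
  ultimately have "s ^ ?n / fact ?n \<le> exp (D * s) * u s z"
    using tendsto_upperbound[of "\<lambda>r. exp (D * r) * u r 0 * (s - r) ^ ?n / fact ?n" _ "at_right (0::real)"]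
    by (simp add: trivial_limit_at_right_real)
  then have "exp (- D * s) * (s ^ ?n / fact ?n) \<le> exp (- D * s) * (exp (D * s) * u s z)"
    by (intro mult_left_mono) auto
  then show ?thesis by (simp add: mult.assoc[symmetric] exp_add[symmetric])
qed

text \<open>
  Any mass at \<open>z\<close> would reach the origin during the additional time \<open>\<tau>\<close>, where the solution is finite. As
  the solution exists for all times, \<open>\<tau>\<close> can be taken as large as desired; this is what excludes
  mass coming in from infinity.
\<close>

lemma a_priori_bound:
  assumes "0 < s" "s \<le> t" "0 < \<tau>"
  shows "u s z \<le> exp (D * (t + \<tau>)) * u (t + \<tau>) 0 * fact (l1 z) / \<tau> ^ l1 z"
proof -
  have "1 * u s z \<le> exp (D * s) * u s z"
    using assms u_nonneg[OF assms(1)] by (intro mult_right_mono) (auto simp: D_def)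
  then have "u s z * \<tau> ^ l1 z \<le> exp (D * s) * u s z * (t + \<tau> - s) ^ l1 z"
    using assms u_nonneg[OF assms(1)] by (intro mult_mono power_mono) auto
  also have "\<dots> \<le> exp (D * (t + \<tau>)) * u (t + \<tau>) 0 * fact (l1 z)"
    using propagation[OF assms(1), of "t + \<tau>" 0 z "l1 z"] assms l1_minus_commute[of 0 z] by (simp add: field_simps)
  finally show ?thesis using assms by (simp add: field_simps)
qed

end

section \<open>Supersolutions\<close>

lemma power_div_fact_le_exp:
  fixes x :: real
  assumes "0 \<le> x"
  shows "x ^ n / fact n \<le> exp x"
proof -
  have "(\<Sum>k\<in>{n}. x ^ k /\<^sub>R fact k) \<le> (\<Sum>k. x ^ k /\<^sub>R fact k)"
    using assms by (intro sum_le_suminf summable_exp_generic) auto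
  then show ?thesis by (simp add: exp_def divide_inverse mult.commute)
qed

lemma DERIV_imp_tendsto_at_right:
  fixes f :: "real \<Rightarrow> real"
  assumes "(f has_real_derivative f') (at x)"
  shows "(f \<longlongrightarrow> f x) (at_right x)"
  by (rule tendsto_mono[OF at_le[OF subset_UNIV] isContD[OF DERIV_isCont[OF assms]]])

context pam begin

lemma D_ge_2: "2 \<le> D"
proof -
  have "1 \<le> real CARD('d)" by (simp add: Suc_leI)
  then show ?thesis unfolding D_def by linarith
qed

lemma laplacian_le:
  fixes z :: "int ^ 'd"
  assumes "\<And>y. y \<in> lattice_neighbours z \<Longrightarrow> f y \<le> f z + e" "0 \<le> e"
  shows "discrete_laplacian f z \<le> D * e"
proof -
  have "discrete_laplacian f z \<le> (\<Sum>y\<in>lattice_neighbours z. e)"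
    unfolding discrete_laplacian_def using assms(1) by (intro sum_mono) (auto simp: diff_le_eq add.commute)
  also have "\<dots> \<le> D * e" using mult_right_mono[OF card_neighbours_le assms(2)] by simp
  finally show ?thesis .
qed

text \<open>
  The maximum principle applied to \<open>w - u\<close>. The initial values of \<open>w\<close> enter through the limit \<open>l\<close>, as they do for \<open>u\<close>.
\<close>

lemma comparison:
  assumes "finite B"
    and deriv: "\<And>s z. 0 < s \<Longrightarrow> s \<le> t \<Longrightarrow> z \<in> B \<Longrightarrow> ((\<lambda>s. w s z) has_real_derivative w' s z) (at s)"
    and super: "\<And>s z. 0 < s \<Longrightarrow> s \<le> t \<Longrightarrow> z \<in> B \<Longrightarrow> discrete_laplacian (w s) z + V z * w s z \<le> w' s z"
    and boundary: "\<And>s z y. 0 < s \<Longrightarrow> s \<le> t \<Longrightarrow> z \<in> B \<Longrightarrow> y \<in> lattice_neighbours z \<Longrightarrow> y \<notin> B \<Longrightarrow> u s y \<le> w s y"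
    and initial: "\<And>z. z \<in> B \<Longrightarrow> ((\<lambda>s. w s z) \<longlongrightarrow> l z) (at_right 0)"
      "\<And>z. z \<in> B \<Longrightarrow> (if z = 0 then 1 else 0) \<le> l z"
    and "0 < s" "s \<le> t" "z \<in> B"
  shows "u s z \<le> w s z"
proof -
  have "0 \<le> w s z - u s z"
  proof (rule finite_max_principle[where f = "\<lambda>s z. w s z - u s z" and V = V and T = t and B = B
        and f' = "\<lambda>s z. w' s z - (discrete_laplacian (u s) z + V z * u s z)"
        and l = "\<lambda>z. l z - (if z = 0 then 1 else 0)"])
    fix s z assume "0 < s" "s \<le> t" "z \<in> B"
    then show "((\<lambda>s. w s z - u s z) has_real_derivative w' s z - (discrete_laplacian (u s) z + V z * u s z)) (at s)"
      by (intro DERIV_diff deriv u_deriv)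
    have "discrete_laplacian (\<lambda>z. w s z - u s z) z = discrete_laplacian (w s) z - discrete_laplacian (u s) z"
      unfolding discrete_laplacian_def sum_subtractf[symmetric] by (intro sum.cong) auto
    then show "w' s z - (discrete_laplacian (u s) z + V z * u s z)
        \<ge> discrete_laplacian (\<lambda>z. w s z - u s z) z + V z * (w s z - u s z)"
      using super[OF \<open>0 < s\<close> \<open>s \<le> t\<close> \<open>z \<in> B\<close>] by (simp add: algebra_simps)
  next
    fix z assume "z \<in> B"
    then show "((\<lambda>s. w s z - u s z) \<longlongrightarrow> l z - (if z = 0 then 1 else 0)) (at_right 0)"
      by (intro tendsto_diff initial(1) u_initial)
  qed (use assms in \<open>auto simp: diff_ge_0_iff_ge\<close>)
  then show ?thesis by simp
qed

text \<open>
  The term with index \<open>k\<close> bounds the contribution of the paths from the origin whose largest distance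
  from the origin is \<open>k\<close>; such paths see only the potential in the ball of radius \<open>k\<close>.
\<close>

definition range_sum :: "(nat \<Rightarrow> real) \<Rightarrow> real \<Rightarrow> nat \<Rightarrow> real \<Rightarrow> int ^ 'd \<Rightarrow> real" where
  "range_sum \<mu> \<theta> N s z = (\<Sum>k\<in>{l1 z..N}. exp (\<mu> k * s) * \<theta> ^ k)"

lemma range_sum_nonneg: "0 < \<theta> \<Longrightarrow> 0 \<le> range_sum \<mu> \<theta> N s z"
  unfolding range_sum_def by (intro sum_nonneg) auto

lemma range_sum_deriv:
  "((\<lambda>s. range_sum \<mu> \<theta> N s z) has_real_derivative (\<Sum>k\<in>{l1 z..N}. \<mu> k * (exp (\<mu> k * s) * \<theta> ^ k))) (at s)"
  unfolding range_sum_def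
proof (rule DERIV_sum)
  fix k show "((\<lambda>s. exp (\<mu> k * s) * \<theta> ^ k) has_real_derivative \<mu> k * (exp (\<mu> k * s) * \<theta> ^ k)) (at s)"
    by (auto intro!: derivative_eq_intros)
qed

lemma range_sum_initial:
  assumes "0 < \<theta>"
  shows "((\<lambda>s. range_sum \<mu> \<theta> N s z) \<longlongrightarrow> range_sum \<mu> \<theta> N 0 z) (at_right 0)"
    and "(if z = 0 then 1 else 0) \<le> range_sum \<mu> \<theta> N 0 z"
proof -
  show "((\<lambda>s. range_sum \<mu> \<theta> N s z) \<longlongrightarrow> range_sum \<mu> \<theta> N 0 z) (at_right 0)"
    by (rule DERIV_imp_tendsto_at_right[OF range_sum_deriv])
  have "exp (\<mu> 0 * 0) * \<theta> ^ 0 \<le> range_sum \<mu> \<theta> N 0 0"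
    unfolding range_sum_def by (rule member_le_sum) (use assms in auto)
  then show "(if z = 0 then 1 else 0) \<le> range_sum \<mu> \<theta> N 0 z"
    using range_sum_nonneg[OF assms] by auto
qed

text \<open>
  The summand \<open>k\<close> is constant in space on the ball of radius \<open>k\<close>, so it is a supersolution there, with a surplus
  of \<open>\<eta>\<close> times itself. Its outflow to the sphere of radius \<open>k + 1\<close> is balanced by the surplus of the next
  summand on that sphere; this is the condition \<open>D \<le> \<theta> * \<eta>\<close>.
\<close>

lemma range_sum_super:
  assumes "mono \<mu>" "0 < \<theta>" "D \<le> \<theta> * \<eta>" "V z + \<eta> \<le> \<mu> (l1 z)" "l1 z \<le> N" "0 \<le> s"
  shows "discrete_laplacian (range_sum \<mu> \<theta> N s) z + V z * range_sum \<mu> \<theta> N s z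
    \<le> (\<Sum>k\<in>{l1 z..N}. \<mu> k * (exp (\<mu> k * s) * \<theta> ^ k))"
proof -
  define j where "j = l1 z"
  \<comment> \<open>The jump of the sum between the sphere of radius j and the sphere before it.\<close>
  define e where "e = (if j = 0 then 0 else exp (\<mu> (j - 1) * s) * \<theta> ^ (j - 1))"
  have e0: "0 \<le> e" using assms by (simp add: e_def)
  have "0 < \<theta> * \<eta>" using assms(3) D_ge_2 by linarith
  then have \<eta>: "0 < \<eta>" using assms(2) by (simp add: zero_less_mult_iff)
  have 1: "discrete_laplacian (range_sum \<mu> \<theta> N s) z \<le> D * e"
  proof (rule laplacian_le[OF _ e0])
    fix y assume "y \<in> lattice_neighbours z"
    then have "j \<le> Suc (l1 y)" using l1_neighbour0 by (auto simp: j_def)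
    then have "range_sum \<mu> \<theta> N s y \<le> (\<Sum>k\<in>{j - 1..N}. exp (\<mu> k * s) * \<theta> ^ k)"
      unfolding range_sum_def using assms by (intro sum_mono2) auto
    also have "\<dots> = range_sum \<mu> \<theta> N s z + e"
    proof (cases "j = 0")
      case False
      moreover have "j \<le> N" using assms(5) by (simp add: j_def)
      ultimately have "{j - 1..N} = insert (j - 1) {j..N}" "j - 1 \<notin> {j..N}" by auto
      then show ?thesis using False by (simp add: range_sum_def e_def j_def)
    qed (simp add: range_sum_def e_def j_def)
    finally show "range_sum \<mu> \<theta> N s y \<le> range_sum \<mu> \<theta> N s z + e" .
  qed
  have \<mu>: "V z \<le> \<mu> k" if "k \<in> {j..N}" for k
    using monoD[OF assms(1), of j k] assms(4) that \<eta> by (simp add: j_def)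
  have "D * e \<le> \<eta> * (exp (\<mu> j * s) * \<theta> ^ j)"
  proof (cases "j = 0")
    case False
    have "\<mu> (j - 1) * s \<le> \<mu> j * s" using monoD[OF assms(1), of "j - 1" j] assms(6) by (intro mult_right_mono) auto
    then have "e \<le> exp (\<mu> j * s) * \<theta> ^ (j - 1)"
      unfolding e_def using False assms(2) by simp
    then have "D * e \<le> (\<theta> * \<eta>) * (exp (\<mu> j * s) * \<theta> ^ (j - 1))"
      using e0 assms(2,3) \<eta> by (intro mult_mono) auto
    also have "\<dots> = \<eta> * (exp (\<mu> j * s) * \<theta> ^ j)" using False by (simp add: power_eq_if)
    finally show ?thesis .
  qed (use \<eta> in \<open>simp add: e_def\<close>)
  also have "\<dots> \<le> (\<mu> j - V z) * (exp (\<mu> j * s) * \<theta> ^ j)"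
    using assms by (intro mult_right_mono) (auto simp: j_def)
  also have "\<dots> \<le> (\<Sum>k\<in>{j..N}. (\<mu> k - V z) * (exp (\<mu> k * s) * \<theta> ^ k))"
    using assms(2,5) \<mu> by (intro member_le_sum mult_nonneg_nonneg) (auto simp: j_def)
  also have "\<dots> = (\<Sum>k\<in>{j..N}. \<mu> k * (exp (\<mu> k * s) * \<theta> ^ k)) - V z * range_sum \<mu> \<theta> N s z"
    by (simp add: range_sum_def j_def sum_distrib_left sum_subtractf left_diff_distrib)
  finally show ?thesis using 1 by (simp add: j_def)
qed

end

text \<open>
  At most linear growth of the potential suffices: over the time \<open>t\<close> it multiplies the mass at
  distance \<open>N\<close> by a factor exponential in \<open>N\<close>, and the time gap in \<open>a_priori_bound\<close> can be chosen to
  beat it.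
\<close>

locale pam_growth = pam +
  fixes C \<kappa> t :: real
  assumes growth: "V z \<le> C + \<kappa> * real (l1 z)" and \<kappa>_nonneg: "0 \<le> \<kappa>" and t_pos: "0 < t"
begin

lemma C_nonneg: "0 \<le> C" using growth[of 0] V_nonneg[of 0] by simp

text \<open>
  The factor \<open>2\<close> produces the decay \<open>(1 / 2) ^ N\<close> of the barrier; the summand \<open>1\<close> in the exponent pays
  for the power of \<open>N\<close> by which the barrier at a fixed site exceeds its value at the origin.
\<close>

definition "time_gap = 2 * exp (1 + (\<kappa> + D) * t)"

definition "barrier_rate N = C + (\<kappa> + D) * real N"

definition "barrier_height N =
  exp (D * (t + time_gap)) * u (t + time_gap) 0 * fact (Suc N) / time_gap ^ Suc N"

text \<open>
  A supersolution on the ball of radius \<open>N\<close> that dominates the solution on the sphere around it and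
  decays by a factor \<open>N\<close> with each step into the ball.
\<close>

definition barrier :: "nat \<Rightarrow> real \<Rightarrow> int ^ 'a \<Rightarrow> real" where
  "barrier N s z = barrier_height N * exp (barrier_rate N * s) * real N ^ l1 z / real N ^ Suc N"

lemma time_gap_pos: "0 < time_gap" by (simp add: time_gap_def)

lemma barrier_rate_nonneg: "0 \<le> barrier_rate N"
  using C_nonneg \<kappa>_nonneg D_ge_2 by (simp add: barrier_rate_def)

lemma barrier_height_nonneg: "0 \<le> barrier_height N"
  using time_gap_pos t_pos u_nonneg[of "t + time_gap" 0] by (simp add: barrier_height_def)

lemma barrier_nonneg: "0 \<le> barrier N s z"
  using barrier_height_nonneg by (simp add: barrier_def)

lemma barrier_deriv: "((\<lambda>s. barrier N s z) has_real_derivative barrier_rate N * barrier N s z) (at s)"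
proof -
  have "((\<lambda>s. barrier_height N * exp (barrier_rate N * s) * real N ^ l1 z) has_real_derivative
      barrier_rate N * (barrier_height N * exp (barrier_rate N * s) * real N ^ l1 z)) (at s)"
    by (auto intro!: derivative_eq_intros)
  from DERIV_cdivide[OF this, of "real N ^ Suc N"] show ?thesis
    by (simp only: barrier_def times_divide_eq_right)
qed

lemma barrier_initial: "((\<lambda>s. barrier N s z) \<longlongrightarrow> barrier N 0 z) (at_right 0)"
  by (rule DERIV_imp_tendsto_at_right[OF barrier_deriv])

lemma barrier_super:
  assumes "1 \<le> N" "l1 z \<le> N"
  shows "discrete_laplacian (barrier N s) z + V z * barrier N s z \<le> barrier_rate N * barrier N s z"
proof -
  have N: "1 \<le> real N" using assms by simp
  have "discrete_laplacian (barrier N s) z \<le> D * ((real N - 1) * barrier N s z)"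
  proof (rule laplacian_le)
    fix y assume y: "y \<in> lattice_neighbours z"
    have "real N ^ l1 y \<le> real N ^ Suc (l1 z)" using l1_neighbour0[OF y] N by (intro power_increasing) auto
    then have "barrier_height N * exp (barrier_rate N * s) * real N ^ l1 y / real N ^ Suc N
       \<le> barrier_height N * exp (barrier_rate N * s) * real N ^ Suc (l1 z) / real N ^ Suc N"
      using barrier_height_nonneg by (intro divide_right_mono mult_left_mono) auto
    also have "\<dots> = real N * barrier N s z" by (simp add: barrier_def)
    also have "\<dots> = barrier N s z + (real N - 1) * barrier N s z" by (simp add: algebra_simps)
    finally show "barrier N s y \<le> barrier N s z + (real N - 1) * barrier N s z"
      by (simp only: barrier_def)
  qed (use N barrier_nonneg in auto)
  also have "\<dots> \<le> D * (real N * barrier N s z)"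
    using N barrier_nonneg D_ge_2 by (intro mult_left_mono mult_right_mono) auto
  finally have 1: "discrete_laplacian (barrier N s) z \<le> D * real N * barrier N s z" by simp
  have "V z \<le> C + \<kappa> * real N"
    using growth[of z] assms(2) \<kappa>_nonneg mult_left_mono[of "real (l1 z)" "real N" \<kappa>] by simp
  then have "V z * barrier N s z \<le> (C + \<kappa> * real N) * barrier N s z"
    by (intro mult_right_mono barrier_nonneg)
  then show ?thesis using 1 by (simp add: barrier_rate_def algebra_simps)
qed

lemma barrier_boundary:
  assumes "1 \<le> N" "l1 z = Suc N" "0 < s" "s \<le> t"
  shows "u s z \<le> barrier N s z"
proof -
  have "u s z \<le> barrier_height N"
    using a_priori_bound[OF assms(3,4) time_gap_pos, of z] assms(2) by (simp add: barrier_height_def)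
  also have "\<dots> \<le> barrier_height N * exp (barrier_rate N * s)"
    using mult_left_mono[OF _ barrier_height_nonneg, of 1 "exp (barrier_rate N * s)" N]
      barrier_rate_nonneg[of N] assms by simp
  also have "\<dots> = barrier N s z" using assms by (simp add: barrier_def)
  finally show ?thesis .
qed

text \<open>
  The factorial in the a priori bound is cancelled by the \<open>N + 1\<close> factors \<open>1 / N\<close> between the boundary and the
  origin. What remains is exponential in \<open>N\<close>, and the time gap turns it into \<open>(1 / 2) ^ N\<close>.
\<close>

lemma barrier_vanishes: "(\<lambda>N. barrier N t z) \<longlonglongrightarrow> 0"
proof -
  define j where "j = l1 z"
  define c where "c = exp (D * (t + time_gap)) * u (t + time_gap) 0 * exp (C * t) * 2 * fact j / time_gap"
  have "barrier N t z \<le> c * (1 / 2) ^ N" if N: "1 \<le> N" for N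
  proof -
    have n: "0 < real N" using N by simp
    have "fact (Suc N) \<le> (real N + 1) * real N ^ N"
      using mult_left_mono[OF fact_le_power[of N, where 'a = real], of "real N + 1"] by (simp add: algebra_simps)
    also have "\<dots> \<le> (2 * real N) * real N ^ N" using N by (intro mult_right_mono) auto
    finally have 1: "fact (Suc N) / real N ^ Suc N \<le> 2" using n by (simp add: field_simps)
    have "(real N) ^ j / fact j \<le> exp (real N)"
      by (rule power_div_fact_le_exp) simp
    then have 2: "real N ^ j \<le> fact j * exp (real N)" by (simp add: field_simps)
    have "exp (barrier_rate N * t) = exp (C * t) * exp ((\<kappa> + D) * t) ^ N"
      by (simp add: barrier_rate_def exp_add[symmetric] exp_of_nat_mult[symmetric] algebra_simps)
    then have "barrier N t z = (exp (D * (t + time_gap)) * u (t + time_gap) 0) * exp (C * t) *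
       (fact (Suc N) / real N ^ Suc N) * real N ^ j * (exp ((\<kappa> + D) * t) ^ N / time_gap ^ Suc N)"
      by (simp add: barrier_def barrier_height_def j_def field_simps)
    also have "\<dots> \<le> (exp (D * (t + time_gap)) * u (t + time_gap) 0) * exp (C * t) *
       2 * (fact j * exp (real N)) * (exp ((\<kappa> + D) * t) ^ N / time_gap ^ Suc N)"
      using time_gap_pos t_pos u_nonneg[of "t + time_gap" 0] 1 2 by (intro mult_mono mult_nonneg_nonneg) auto
    also have "\<dots> = c * (exp (real N) * exp ((\<kappa> + D) * t) ^ N / time_gap ^ N)"
      by (simp add: c_def field_simps)
    also have "exp (real N) = exp 1 ^ N" by (simp add: exp_of_nat_mult[symmetric])
    also have "exp 1 ^ N * exp ((\<kappa> + D) * t) ^ N / time_gap ^ N = (1/2) ^ N"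
      unfolding power_mult_distrib[symmetric] power_divide[symmetric] time_gap_def exp_add by simp
    finally show ?thesis .
  qed
  moreover have "(\<lambda>N. c * (1 / 2) ^ N) \<longlonglongrightarrow> 0"
    by (intro tendsto_mult_right_zero LIMSEQ_power_zero) auto
  ultimately show ?thesis
    by (intro tendsto_sandwich[of "\<lambda>_. 0" "\<lambda>N. barrier N t z" sequentially "\<lambda>N. c * (1 / 2) ^ N"])
      (auto simp: barrier_nonneg intro!: eventually_sequentiallyI[of 1])
qed

text \<open>
  Comparison on the ball of radius \<open>N\<close>: in the interior the sum over ranges is the relevant term, and on the
  outer boundary, where that sum is empty, the barrier takes over.
\<close>

lemma global_bound:
  assumes "mono \<mu>" "0 < \<theta>" "D \<le> \<theta> * \<eta>" "\<And>z. V z + \<eta> \<le> \<mu> (l1 z)"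
    and "1 \<le> N" "l1 z \<le> N" "0 < s" "s \<le> t"
  shows "u s z \<le> range_sum \<mu> \<theta> N s z + barrier N s z"
proof (rule comparison[where B = "{z. l1 z \<le> N}" and t = t])
  fix s :: real and z :: "int ^ 'a" assume s: "0 < s" "s \<le> t" and z: "z \<in> {z. l1 z \<le> N}"
  show "((\<lambda>s. range_sum \<mu> \<theta> N s z + barrier N s z) has_real_derivative
      (\<Sum>k\<in>{l1 z..N}. \<mu> k * (exp (\<mu> k * s) * \<theta> ^ k)) + barrier_rate N * barrier N s z) (at s)"
    by (intro DERIV_add range_sum_deriv barrier_deriv)
  have "discrete_laplacian (\<lambda>z. range_sum \<mu> \<theta> N s z + barrier N s z) z
     = discrete_laplacian (range_sum \<mu> \<theta> N s) z + discrete_laplacian (barrier N s) z"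
    unfolding discrete_laplacian_def sum.distrib[symmetric] by (intro sum.cong) auto
  moreover have "discrete_laplacian (range_sum \<mu> \<theta> N s) z + V z * range_sum \<mu> \<theta> N s z
    \<le> (\<Sum>k\<in>{l1 z..N}. \<mu> k * (exp (\<mu> k * s) * \<theta> ^ k))"
    by (rule range_sum_super) (use assms s z in auto)
  moreover have "discrete_laplacian (barrier N s) z + V z * barrier N s z \<le> barrier_rate N * barrier N s z"
    by (rule barrier_super) (use assms z in auto)
  ultimately show "discrete_laplacian (\<lambda>z. range_sum \<mu> \<theta> N s z + barrier N s z) z
      + V z * (range_sum \<mu> \<theta> N s z + barrier N s z)
    \<le> (\<Sum>k\<in>{l1 z..N}. \<mu> k * (exp (\<mu> k * s) * \<theta> ^ k)) + barrier_rate N * barrier N s z"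
    by (simp add: distrib_left)
  fix y assume y: "y \<in> lattice_neighbours z" "y \<notin> {z. l1 z \<le> N}"
  then have "l1 y = Suc N" using l1_neighbour0[OF y(1)] z by auto
  then show "u s y \<le> range_sum \<mu> \<theta> N s y + barrier N s y"
    using barrier_boundary[OF assms(5) _ s] range_sum_nonneg[OF assms(2), of \<mu> N s y] by force
next
  fix z :: "int ^ 'a"
  show "((\<lambda>s. range_sum \<mu> \<theta> N s z + barrier N s z) \<longlongrightarrow> range_sum \<mu> \<theta> N 0 z + barrier N 0 z) (at_right 0)"
    by (intro tendsto_add range_sum_initial(1) barrier_initial assms)
  show "(if z = 0 then 1 else 0) \<le> range_sum \<mu> \<theta> N 0 z + barrier N 0 z"
    using range_sum_initial(2)[OF assms(2), of z \<mu> N] barrier_nonneg[of N 0 z] by linarith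
qed (use assms finite_l1_ball in auto)

text \<open>
  Here the profile \<open>\<mu>\<close> may lie below the potential at \<open>A\<close> as long as the distance is at most \<open>R\<close>. The first
  summand on the right accounts for the paths through \<open>A\<close>: on the ball of radius \<open>R\<close> without \<open>A\<close> it is a
  supersolution, and at \<open>A\<close> it dominates \<open>u\<close> by \<open>growth_at_site\<close>. On the outer boundary the bound by ranges is
  available, because a profile raised to the level of the peak coincides with \<open>\<mu>\<close> beyond \<open>R\<close>.
\<close>

lemma local_bound:
  assumes "mono \<mu>" "0 < \<theta>" "\<theta> \<le> 1" "D \<le> \<theta> * \<eta>"
    and off_peak: "\<And>z. z \<noteq> A \<Longrightarrow> V z + \<eta> \<le> \<mu> (l1 z)"
    and beyond: "V A + \<eta> \<le> \<mu> (Suc R)"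
    and inside: "\<And>z. z \<noteq> A \<Longrightarrow> l1 z \<le> R \<Longrightarrow> V z + \<eta> \<le> V A"
    and "R < N" "l1 z \<le> N" "z \<noteq> A" "0 < s" "s \<le> t"
  shows "u s z \<le> exp (- (V A - D) * (t - s)) * u t A * \<theta> ^ l1 (z - A) + (range_sum \<mu> \<theta> N s z + barrier N s z)"
    (is "_ \<le> ?p s z + _")
proof -
  have p0: "0 \<le> ?p s z" for s z using u_nonneg[OF t_pos, of A] assms(2) by auto
  have far: "u s z \<le> range_sum \<mu> \<theta> N s z + barrier N s z"
    if "R < l1 z" "l1 z \<le> N" "0 < s" "s \<le> t" for s z
  proof -
    let ?l = "\<lambda>k. max (\<mu> k) (V A + \<eta>)"
    have "u s z \<le> range_sum ?l \<theta> N s z + barrier N s z"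
    proof (rule global_bound[OF _ assms(2,4)])
      show "mono ?l" by (intro monoI max.mono monoD[OF assms(1)]) auto
      show "V z + \<eta> \<le> ?l (l1 z)" for z using off_peak[of z] by (cases "z = A") auto
    qed (use that in auto)
    also have "range_sum ?l \<theta> N s z = range_sum \<mu> \<theta> N s z"
    proof -
      have "?l k = \<mu> k" if "k \<in> {l1 z..N}" for k
        using monoD[OF assms(1), of "Suc R" k] that \<open>R < l1 z\<close> beyond by auto
      then show ?thesis unfolding range_sum_def by (intro sum.cong) auto
    qed
    finally show ?thesis .
  qed
  show ?thesis
  proof (cases "l1 z \<le> R")
    case False
    then show ?thesis using far[of z s] p0[of s z] assms by auto
  next
    case True
    show ?thesis
    proof (rule comparison[where B = "{z. l1 z \<le> R} - {A}" and t = t])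
      fix s :: real and z :: "int ^ 'a" assume s: "0 < s" "s \<le> t" and z: "z \<in> {z. l1 z \<le> R} - {A}"
      have "((\<lambda>s. ?p s z) has_real_derivative (V A - D) * ?p s z) (at s)"
        by (auto intro!: derivative_eq_intros)
      then show "((\<lambda>s. ?p s z + (range_sum \<mu> \<theta> N s z + barrier N s z)) has_real_derivative
          (V A - D) * ?p s z + ((\<Sum>k\<in>{l1 z..N}. \<mu> k * (exp (\<mu> k * s) * \<theta> ^ k)) + barrier_rate N * barrier N s z)) (at s)"
        by (intro DERIV_add range_sum_deriv barrier_deriv)
      have "discrete_laplacian (\<lambda>z. ?p s z + (range_sum \<mu> \<theta> N s z + barrier N s z)) z
         = discrete_laplacian (?p s) z + (discrete_laplacian (range_sum \<mu> \<theta> N s) z + discrete_laplacian (barrier N s) z)"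
        unfolding discrete_laplacian_def sum.distrib[symmetric] by (intro sum.cong) auto
      moreover have "discrete_laplacian (range_sum \<mu> \<theta> N s) z + V z * range_sum \<mu> \<theta> N s z
        \<le> (\<Sum>k\<in>{l1 z..N}. \<mu> k * (exp (\<mu> k * s) * \<theta> ^ k))"
        by (rule range_sum_super[where \<eta> = \<eta>]) (use assms s z in auto)
      moreover have "discrete_laplacian (barrier N s) z + V z * barrier N s z \<le> barrier_rate N * barrier N s z"
        by (rule barrier_super) (use assms z in auto)
      moreover have "discrete_laplacian (?p s) z + V z * ?p s z \<le> (V A - D) * ?p s z"
      proof -
        have "discrete_laplacian (?p s) z \<le> D * ((1 / \<theta> - 1) * ?p s z)"
        proof (rule laplacian_le)
          fix y assume y: "y \<in> lattice_neighbours z"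
          have "\<theta> ^ l1 (y - A) \<le> \<theta> ^ (l1 (z - A) - 1)"
            using l1_neighbour(2)[OF y, of A] assms(2,3) by (intro power_decreasing) auto
          also have "\<dots> = \<theta> ^ l1 (z - A) / \<theta>"
            using z assms(2) by (simp add: power_eq_if)
          finally have "?p s y \<le> exp (- (V A - D) * (t - s)) * u t A * (\<theta> ^ l1 (z - A) / \<theta>)"
            using u_nonneg[OF t_pos, of A] by (intro mult_left_mono) auto
          also have "\<dots> = ?p s z + (1 / \<theta> - 1) * ?p s z" by (simp add: algebra_simps)
          finally show "?p s y \<le> ?p s z + (1 / \<theta> - 1) * ?p s z" .
        qed (use assms(2,3) p0 in \<open>auto intro!: mult_nonneg_nonneg\<close>)
        also have "\<dots> = (D / \<theta> - D) * ?p s z" by (simp add: algebra_simps)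
        also have "\<dots> \<le> (V A - V z - D) * ?p s z"
        proof (rule mult_right_mono[OF _ p0])
          have "D / \<theta> \<le> \<eta>" using assms(2,4) by (simp add: field_simps)
          then show "D / \<theta> - D \<le> V A - V z - D" using inside[of z] z by auto
        qed
        finally show ?thesis by (simp add: algebra_simps)
      qed
      ultimately show "discrete_laplacian (\<lambda>z. ?p s z + (range_sum \<mu> \<theta> N s z + barrier N s z)) z
          + V z * (?p s z + (range_sum \<mu> \<theta> N s z + barrier N s z))
        \<le> (V A - D) * ?p s z + ((\<Sum>k\<in>{l1 z..N}. \<mu> k * (exp (\<mu> k * s) * \<theta> ^ k)) + barrier_rate N * barrier N s z)"
        by (simp only: distrib_left)
      fix y assume y: "y \<in> lattice_neighbours z" "y \<notin> {z. l1 z \<le> R} - {A}"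
      show "u s y \<le> ?p s y + (range_sum \<mu> \<theta> N s y + barrier N s y)"
      proof (cases "y = A")
        case True
        then show ?thesis
          using growth_at_site[OF s, of A] range_sum_nonneg[OF assms(2), of \<mu> N s y] barrier_nonneg[of N s y] by simp
      next
        case False
        then have "R < l1 y" "l1 y \<le> N" using y l1_neighbour0[OF y(1)] z assms by auto
        then show ?thesis using far[OF _ _ s, of y] p0[of s y] by linarith
      qed
    next
      fix z :: "int ^ 'a"
      have "((\<lambda>s. ?p s z) has_real_derivative (V A - D) * ?p 0 z) (at 0)"
        by (auto intro!: derivative_eq_intros)
      then have "((\<lambda>s. ?p s z) \<longlongrightarrow> ?p 0 z) (at_right 0)" by (rule DERIV_imp_tendsto_at_right)
      then show "((\<lambda>s. ?p s z + (range_sum \<mu> \<theta> N s z + barrier N s z)) \<longlongrightarrow>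
          ?p 0 z + (range_sum \<mu> \<theta> N 0 z + barrier N 0 z)) (at_right 0)"
        by (intro tendsto_add range_sum_initial(1) barrier_initial assms)
      show "(if z = 0 then 1 else 0) \<le> ?p 0 z + (range_sum \<mu> \<theta> N 0 z + barrier N 0 z)"
        using range_sum_initial(2)[OF assms(2), of z \<mu> N] barrier_nonneg[of N 0 z] p0[of 0 z] by linarith
    qed (use assms finite_l1_ball True in auto)
  qed
qed

end

section \<open>Concentration at an isolated peak\<close>

text \<open>
  For a linear profile \<open>m + p * k\<close> the sum over ranges is geometric. The radius \<open>R\<close> is chosen just below
  the point where the profile overtakes \<open>V A + 4 * \<eta>\<close>; up to \<open>R\<close>
  the other sites are then lower than \<open>A\<close> by \<open>\<eta>\<close>, while beyond \<open>R\<close> the profile covers \<open>A\<close> as well.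
\<close>

lemma (in pam) pointwise_concentration:
  assumes "0 < t" "0 < p" "0 < \<theta>" "\<theta> \<le> 1" "D \<le> \<theta> * \<eta>" "m \<le> V A"
    and separation: "\<And>z. z \<noteq> A \<Longrightarrow> V z + 5 * \<eta> \<le> m + p * real (l1 z)"
    and x: "exp (p * t) * \<theta> \<le> 1 / 2"
    and "z \<noteq> A"
  shows "u t z \<le> u t A * \<theta> ^ l1 (z - A) + 2 * exp (m * t) * (exp (p * t) * \<theta>) ^ l1 z"
proof -
  have "0 < \<theta> * \<eta>" using assms(5) D_ge_2 by linarith
  then have \<eta>: "0 < \<eta>" using assms(3) by (simp add: zero_less_mult_iff)
  interpret pam_growth V u D "V A" p t
  proof unfold_locales
    fix z show "V z \<le> V A + p * real (l1 z)"
      using separation[of z] assms(2,6) \<eta> by (cases "z = A") auto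
  qed (use assms in auto)
  define \<mu> where "\<mu> k = m + p * real k" for k
  define R where "R = nat \<lfloor>(V A + 4 * \<eta> - m) / p\<rfloor>"
  have "0 \<le> (V A + 4 * \<eta> - m) / p" using assms \<eta> by simp
  then have R: "real R \<le> (V A + 4 * \<eta> - m) / p" "(V A + 4 * \<eta> - m) / p \<le> real R + 1"
    unfolding R_def by linarith+
  have \<mu>: "mono \<mu>" unfolding \<mu>_def mono_def using assms(2) by simp
  have bound: "u t z \<le> exp (- (V A - D) * (t - t)) * u t A * \<theta> ^ l1 (z - A) + (range_sum \<mu> \<theta> N t z + barrier N t z)"
    if N: "R + l1 z < N" for N
  proof (rule local_bound[OF \<mu> assms(3-5), where R = R])
    show "V z + \<eta> \<le> \<mu> (l1 z)" if "z \<noteq> A" for z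
      using separation[OF that] \<eta> by (simp add: \<mu>_def)
    show "V A + \<eta> \<le> \<mu> (Suc R)"
      using R(2) assms(2) \<eta> by (simp add: \<mu>_def field_simps)
    fix z assume z: "z \<noteq> A" "l1 z \<le> R"
    have "p * real (l1 z) \<le> p * real R" using z assms(2) by simp
    also have "\<dots> \<le> V A + 4 * \<eta> - m" using R(1) assms(2) by (simp add: field_simps)
    finally show "V z + \<eta> \<le> V A" using separation[OF z(1)] by linarith
  qed (use N assms in auto)
  let ?x = "exp (p * t) * \<theta>"
  have rs: "range_sum \<mu> \<theta> N t z \<le> 2 * exp (m * t) * ?x ^ l1 z" for N
  proof -
    have "range_sum \<mu> \<theta> N t z = (\<Sum>k\<in>{l1 z..N}. exp (m * t) * (?x ^ l1 z * ?x ^ (k - l1 z)))"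
      unfolding range_sum_def \<mu>_def
    proof (rule sum.cong)
      fix k assume "k \<in> {l1 z..N}"
      then have "?x ^ l1 z * ?x ^ (k - l1 z) = ?x ^ k" by (simp only: power_add[symmetric]) simp
      moreover have "exp ((m + p * real k) * t) = exp (m * t) * exp (p * t) ^ k"
        unfolding exp_of_nat_mult[symmetric] exp_add[symmetric] by (simp add: algebra_simps)
      ultimately show "exp ((m + p * real k) * t) * \<theta> ^ k = exp (m * t) * (?x ^ l1 z * ?x ^ (k - l1 z))"
        by (simp add: power_mult_distrib)
    qed simp
    also have "\<dots> \<le> (\<Sum>k\<in>{l1 z..N}. exp (m * t) * (?x ^ l1 z * (1 / 2) ^ (k - l1 z)))"
      using x assms(3) by (intro sum_mono mult_left_mono power_mono) auto
    also have "\<dots> = exp (m * t) * ?x ^ l1 z * (\<Sum>k\<in>{l1 z..N}. (1 / 2) ^ (k - l1 z))"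
      by (simp add: sum_distrib_left mult.assoc)
    also have "\<dots> \<le> exp (m * t) * ?x ^ l1 z * 2"
      using assms(3) by (intro mult_left_mono sum_half_powers_le_2) auto
    finally show ?thesis by (simp add: algebra_simps)
  qed
  have "(\<lambda>N. u t A * \<theta> ^ l1 (z - A) + 2 * exp (m * t) * ?x ^ l1 z + barrier N t z) \<longlonglongrightarrow>
      u t A * \<theta> ^ l1 (z - A) + 2 * exp (m * t) * ?x ^ l1 z + 0"
    by (intro tendsto_intros barrier_vanishes)
  then have "u t z \<le> u t A * \<theta> ^ l1 (z - A) + 2 * exp (m * t) * ?x ^ l1 z + 0"
  proof (rule LIMSEQ_le_const, intro exI[of _ "Suc (R + l1 z)"] allI impI)
    fix N assume "Suc (R + l1 z) \<le> N"
    then have "R + l1 z < N" by simp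
    from bound[OF this] rs[of N]
    show "u t z \<le> u t A * \<theta> ^ l1 (z - A) + 2 * exp (m * t) * ?x ^ l1 z + barrier N t z"
      by simp
  qed
  then show ?thesis by simp
qed

text \<open>
  A bound on finite sums is all that is assumed, so summability is part of what has to be shown: without
  it the infinite sum would be \<open>0\<close> by convention.
\<close>

lemma ratio_to_sum:
  fixes f :: "'a \<Rightarrow> real"
  assumes nonneg: "\<And>z. 0 \<le> f z" and "0 < f A" "0 \<le> e"
    and rest: "\<And>S. finite S \<Longrightarrow> A \<notin> S \<Longrightarrow> sum f S \<le> e * f A"
  shows "\<bar>f A / infsum f UNIV - 1\<bar> \<le> e"
proof -
  have fin: "sum f F \<le> (1 + e) * f A" if "finite F" for F
  proof -
    have "sum f F \<le> sum f (insert A (F - {A}))" using that nonneg by (intro sum_mono2) auto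
    also have "\<dots> = f A + sum f (F - {A})" using that by (subst sum.insert) auto
    also have "\<dots> \<le> f A + e * f A" using rest[of "F - {A}"] that by simp
    finally show ?thesis by (simp add: algebra_simps)
  qed
  have sm: "f summable_on UNIV"
    by (rule nonneg_bdd_above_summable_on) (use nonneg fin in \<open>auto simp: bdd_above_def\<close>)
  have lo: "f A \<le> infsum f UNIV"
    using finite_sum_le_infsum[OF sm, of "{A}"] nonneg by simp
  have up: "infsum f UNIV \<le> (1 + e) * f A"
    by (rule infsum_le_finite_sums[OF sm fin])
  have pos: "0 < infsum f UNIV" using lo assms(2) by linarith
  have "f A / infsum f UNIV \<le> 1" using lo pos by simp
  moreover have "1 - e \<le> f A / infsum f UNIV"
  proof -
    have "(1 - e) * infsum f UNIV \<le> f A"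
    proof (cases "e \<le> 1")
      case True
      then have "(1 - e) * infsum f UNIV \<le> (1 - e) * ((1 + e) * f A)" using up by (intro mult_left_mono) auto
      also have "\<dots> = (1 - e * e) * f A" by (simp add: algebra_simps)
      also have "\<dots> \<le> 1 * f A" using assms(2,3) by (intro mult_right_mono) auto
      finally show ?thesis by simp
    next
      case False
      then have "(1 - e) * infsum f UNIV \<le> 0" using pos by (intro mult_nonpos_nonneg) auto
      then show ?thesis using assms(2) by linarith
    qed
    then show ?thesis using pos by (simp add: field_simps)
  qed
  ultimately show ?thesis by linarith
qed

context pam begin

text \<open>
  The site \<open>A\<close> is reached by a geodesic by time \<open>s = (\<bar>A\<bar> + 1) / a\<close> and never left again. For this \<open>s\<close>
  the factor \<open>s ^ n / fact n\<close> with \<open>n = \<bar>A\<bar>\<close> is at least \<open>(1 / a) ^ n\<close>, and adding \<open>1\<close> to the distance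
  keeps \<open>s\<close> positive if \<open>A\<close> is the origin.
\<close>

lemma peak_lower_bound:
  assumes "1 \<le> a" "(real (l1 A) + 1) / a \<le> t"
  shows "exp (V A * t - V A * ((real (l1 A) + 1) / a) - D * t - real (l1 A) * ln a) \<le> u t A"
proof -
  let ?n = "l1 A"
  define s where "s = (real ?n + 1) / a"
  have s: "0 < s" "s \<le> t" using assms by (auto simp: s_def)
  have "fact ?n \<le> (real ?n + 1) ^ ?n"
    using fact_le_power[of ?n, where 'a = real] power_mono[of "real ?n" "real ?n + 1" ?n] by simp
  then have "(1 / a) ^ ?n * fact ?n \<le> (1 / a) ^ ?n * (real ?n + 1) ^ ?n"
    using assms by (intro mult_left_mono) auto
  also have "\<dots> = s ^ ?n"
    unfolding power_mult_distrib[symmetric] by (simp add: s_def)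
  finally have "(1 / a) ^ ?n \<le> s ^ ?n / fact ?n"
    by (subst pos_le_divide_eq) auto
  then have "exp (- D * s) * (1 / a) ^ ?n \<le> exp (- D * s) * (s ^ ?n / fact ?n)"
    by (intro mult_left_mono) auto
  also have "\<dots> \<le> u s A" using propagation_from_origin[OF s(1), of A] by simp
  also have "\<dots> \<le> exp (- (V A - D) * (t - s)) * u t A" by (rule growth_at_site[OF s])
  finally have "exp ((V A - D) * (t - s)) * (exp (- D * s) * (1 / a) ^ ?n)
      \<le> exp ((V A - D) * (t - s)) * (exp (- (V A - D) * (t - s)) * u t A)"
    by (intro mult_left_mono) auto
  also have "\<dots> = u t A" unfolding mult.assoc[symmetric] exp_add[symmetric] by (simp add: algebra_simps)
  also have "(1 / a) ^ ?n = exp (- (real ?n * ln a))"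
    using assms(1) by (simp add: exp_minus exp_of_nat_mult power_one_over inverse_eq_divide)
  also have "exp ((V A - D) * (t - s)) * (exp (- D * s) * exp (- (real ?n * ln a)))
      = exp (V A * t - V A * s - D * t - real ?n * ln a)"
    unfolding exp_add[symmetric] by (simp add: algebra_simps)
  finally show ?thesis by (simp add: s_def)
qed

text \<open>
  The per-step weight \<open>\<theta> = D / (\<delta> * a)\<close> is larger than the cost \<open>1 / a\<close> charged by \<open>\<kappa>\<close>, which can
  make the sum over ranges diverge. Therefore the slope is lowered to \<open>\<kappa> * (1 - \<rho>)\<close>: interpolating between the
  gap condition and the envelope, whose slope is only \<open>\<kappa> / 2\<close>, costs at most \<open>\<delta> * a\<close> of the gap and
  leaves the ratio \<open>a powr - \<rho> * D / \<delta>\<close>, which is small for large \<open>a\<close>.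
\<close>

lemma concentration:
  assumes "0 < t" "1 \<le> a" "0 < \<kappa>" "\<kappa> * t = ln a" "0 < \<delta>" "0 < K"
    and envelope: "\<And>z. V z \<le> K * a + \<kappa> / 2 * real (l1 z)"
    and gap: "\<And>z. z \<noteq> A \<Longrightarrow> V z - \<kappa> * real (l1 z) + 9 * \<delta> * a \<le> V A - \<kappa> * real (l1 A)"
    and early: "(2 * K * a / \<kappa> + 1) / a \<le> t"
    and \<rho>: "\<rho> = \<delta> / (2 * (9 * \<delta> + K))"
    and small: "2 * D * (D / (\<delta> * a)) \<le> 1" "2 * D * (D / \<delta> * a powr - \<rho>) \<le> 1"
  shows "\<bar>u t A / total_mass (u t) - 1\<bar> \<le>
    2 * D * (D / (\<delta> * a)) + 4 * exp (2 * K * (2 * K * a / \<kappa> + 1) + D * t - 3 * \<delta> * a * t)"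
proof -
  define \<Phi> where "\<Phi> = V A - \<kappa> * real (l1 A)"
  define m where "m = \<Phi> - 3 * \<delta> * a"
  define \<theta> where "\<theta> = D / (\<delta> * a)"
  define \<eta> where "\<eta> = \<delta> * a"
  define p where "p = \<kappa> * (1 - \<rho>)"
  define x where "x = D / \<delta> * a powr - \<rho>"
  have \<eta>: "0 < \<eta>" using assms by (simp add: \<eta>_def)
  have \<theta>: "0 < \<theta>" using assms D_ge_2 by (simp add: \<theta>_def)
  have den: "0 < 2 * (9 * \<delta> + K)" using assms by simp
  then have "2 * \<rho> * (9 * \<delta> + K) = \<delta>" unfolding \<rho> by (simp add: field_simps)
  then have \<rho>1: "0 < \<rho>" "\<rho> < 1" "2 * \<rho> * (9 * \<delta> + K) = \<delta>"
    using den assms(5,6) unfolding \<rho> by (simp_all add: divide_less_eq)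
  have p: "0 < p" using \<rho>1 assms by (simp add: p_def)
  have \<Phi>0: "0 \<le> \<Phi>"
  proof (cases "A = 0")
    case False
    then have "V 0 + 9 * \<delta> * a \<le> \<Phi>" using gap[of 0] by (simp add: \<Phi>_def)
    moreover have "0 \<le> 9 * \<delta> * a" using assms by simp
    ultimately show ?thesis using V_nonneg[of 0] by linarith
  qed (use V_nonneg[of 0] in \<open>simp add: \<Phi>_def\<close>)
  \<comment> \<open>A convex combination of the gap condition and the envelope, with weight 2 * \<rho> on the latter.\<close>
  have separation: "V z + 5 * \<eta> \<le> m + p * real (l1 z)" if "z \<noteq> A" for z
  proof -
    have 1: "(1 - 2 * \<rho>) * V z \<le> (1 - 2 * \<rho>) * (\<Phi> - 9 * \<delta> * a + \<kappa> * real (l1 z))"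
    proof (rule mult_left_mono)
      show "V z \<le> \<Phi> - 9 * \<delta> * a + \<kappa> * real (l1 z)" using gap[OF that] by (simp add: \<Phi>_def)
      have "2 * \<rho> * (9 * \<delta> + K) \<le> 1 * (9 * \<delta> + K)" using \<rho>1 assms by simp
      then show "0 \<le> 1 - 2 * \<rho>" using assms by (subst (asm) mult_le_cancel_right) auto
    qed
    have 2: "(2 * \<rho>) * V z \<le> (2 * \<rho>) * (K * a + \<kappa> / 2 * real (l1 z))"
      by (intro mult_left_mono envelope) (use \<rho>1 in auto)
    have "V z \<le> (1 - 2 * \<rho>) * (\<Phi> - 9 * \<delta> * a + \<kappa> * real (l1 z)) + (2 * \<rho>) * (K * a + \<kappa> / 2 * real (l1 z))"
      using 1 2 by (simp add: algebra_simps)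
    also have "\<dots> = \<Phi> - 9 * \<delta> * a + p * real (l1 z) + (2 * \<rho> * (9 * \<delta> + K)) * a - 2 * \<rho> * \<Phi>"
      by (simp add: p_def algebra_simps)
    also have "\<dots> \<le> \<Phi> - 8 * \<delta> * a + p * real (l1 z)"
      unfolding \<rho>1(3) using \<rho>1(1) \<Phi>0 by simp
    finally show ?thesis by (simp add: m_def \<eta>_def)
  qed
  have xp: "exp (p * t) * \<theta> = x"
  proof -
    have "p * t = (1 - \<rho>) * ln a" using assms(4) by (simp add: p_def algebra_simps)
    then have "exp (p * t) = a powr (1 + (- \<rho>))" using assms(2) by (simp add: powr_def)
    also have "\<dots> = a * a powr - \<rho>" using assms(2) by (subst powr_add) auto
    finally show ?thesis using assms(2,5) by (simp add: x_def \<theta>_def field_simps)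
  qed
  have x: "0 \<le> x" "2 * D * x \<le> 1" using assms D_ge_2 by (auto simp: x_def)
  have half: "y \<le> 1 / 2" if "2 * D * y \<le> 1" "0 \<le> y" for y
    using mult_right_mono[OF D_ge_2 that(2)] that by linarith
  have \<theta>_half: "\<theta> \<le> 1 / 2" by (rule half) (use small(1) \<theta> in \<open>simp_all add: \<theta>_def\<close>)
  have A: "\<kappa> * real (l1 A) \<le> V A" using \<Phi>0 by (simp add: \<Phi>_def)
  have nA: "real (l1 A) \<le> 2 * K * a / \<kappa>"
    using A envelope[of A] assms(3) by (simp add: field_simps)
  then have "\<kappa> * real (l1 A) \<le> 2 * K * a" using assms(3) by (simp add: field_simps)
  then have VA: "V A \<le> 2 * K * a" using envelope[of A] by simp
  have time: "(real (l1 A) + 1) / a \<le> t"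
    using early nA assms(2) by (smt (verit) divide_right_mono)
  have "V A * ((real (l1 A) + 1) / a) \<le> (2 * K * a) * ((2 * K * a / \<kappa> + 1) / a)"
    using VA nA assms V_nonneg[of A] by (intro mult_mono divide_right_mono) auto
  also have "\<dots> = 2 * K * (2 * K * a / \<kappa> + 1)" using assms(2) by simp
  finally have cost: "V A * ((real (l1 A) + 1) / a) \<le> 2 * K * (2 * K * a / \<kappa> + 1)" .
  have low: "exp (V A * t - V A * ((real (l1 A) + 1) / a) - D * t - real (l1 A) * ln a) \<le> u t A"
    by (rule peak_lower_bound[OF assms(2) time])
  define E where "E = 2 * K * (2 * K * a / \<kappa> + 1) + D * t - 3 * \<delta> * a * t"
  have "exp (m * t) \<le> exp E * exp (V A * t - V A * ((real (l1 A) + 1) / a) - D * t - real (l1 A) * ln a)"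
    unfolding exp_add[symmetric] using cost
    by (simp add: E_def m_def \<Phi>_def assms(4)[symmetric] algebra_simps)
  also have "\<dots> \<le> exp E * u t A" using low by simp
  finally have peak: "exp (m * t) \<le> exp E * u t A" .
  have uA: "0 < u t A" using low by (rule less_le_trans[OF exp_gt_zero])
  have "\<bar>u t A / infsum (u t) UNIV - 1\<bar> \<le> 2 * D * \<theta> + 4 * exp E"
  proof (rule ratio_to_sum)
    fix S :: "(int ^ 'd) set" assume S: "finite S" "A \<notin> S"
    have "sum (u t) S \<le> (\<Sum>z\<in>S. u t A * \<theta> ^ l1 (z - A) + 2 * exp (m * t) * x ^ l1 z)"
    proof (rule sum_mono)
      fix z assume "z \<in> S"
      then have zA: "z \<noteq> A" using S by auto
      have "u t z \<le> u t A * \<theta> ^ l1 (z - A) + 2 * exp (m * t) * (exp (p * t) * \<theta>) ^ l1 z"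
      proof (rule pointwise_concentration[OF assms(1) p \<theta> _ _ _ separation _ zA])
        show "\<theta> \<le> 1" using \<theta>_half by linarith
        show "D \<le> \<theta> * \<eta>" using assms by (simp add: \<theta>_def \<eta>_def)
        have "0 \<le> \<kappa> * real (l1 A)" "0 \<le> 3 * \<delta> * a" using assms by auto
        then show "m \<le> V A" by (simp add: m_def \<Phi>_def)
        show "exp (p * t) * \<theta> \<le> 1 / 2" unfolding xp by (rule half[OF x(2,1)])
      qed
      then show "u t z \<le> u t A * \<theta> ^ l1 (z - A) + 2 * exp (m * t) * x ^ l1 z" unfolding xp .
    qed
    also have "\<dots> = u t A * (\<Sum>z\<in>S. \<theta> ^ l1 (z - A)) + 2 * exp (m * t) * (\<Sum>z\<in>S. x ^ l1 (z - 0))"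
      by (simp add: sum.distrib sum_distrib_left)
    also have "\<dots> \<le> u t A * (2 * (2 * real CARD('d) * \<theta>) ^ 1) + 2 * exp (m * t) * (2 * (2 * real CARD('d) * x) ^ 0)"
    proof (intro add_mono mult_left_mono sum_l1_power_le)
      fix z assume "z \<in> S"
      then have "z - A \<noteq> 0" using S by auto
      then show "1 \<le> l1 (z - A)" using l1_eq_0_iff[of "z - A"] by linarith
    qed (use S uA \<theta> x small(1) in \<open>auto simp: \<theta>_def D_def\<close>)
    also have "\<dots> = u t A * (2 * D * \<theta>) + 4 * exp (m * t)" by (simp add: D_def)
    also have "\<dots> \<le> (2 * D * \<theta> + 4 * exp E) * u t A" using peak by (simp add: algebra_simps)
    finally show "sum (u t) S \<le> (2 * D * \<theta> + 4 * exp E) * u t A" .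
  qed (use u_nonneg[OF assms(1)] uA \<theta> D_ge_2 in auto)
  then show ?thesis by (simp add: total_mass_def \<theta>_def E_def)
qed

end

text \<open>
  On the time scale \<open>t = a powr \<beta> * ln a\<close> the gain \<open>a * t\<close> has order \<open>a powr (1 + \<beta>) * ln a\<close> and beats both
  \<open>t\<close> and \<open>a powr (1 + \<beta>)\<close>, the order of the distance of the peak.
\<close>

lemma concentration_error_tendsto_0:
  fixes \<beta> \<delta> K D :: real
  assumes "0 < \<beta>" "0 < \<delta>" "0 < K" "0 < D"
  shows "((\<lambda>a. 2 * D * (D / (\<delta> * a)) +
      4 * exp (2 * K * (2 * K * a / a powr - \<beta> + 1) + D * (a powr \<beta> * ln a) - 3 * \<delta> * a * (a powr \<beta> * ln a)))
      \<longlongrightarrow> 0) at_top"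
  using assms by real_asymp

lemma eventually_early_and_small:
  fixes \<beta> \<delta> K D \<rho> :: real
  assumes "0 < \<beta>" "0 < \<delta>" "0 < K" "0 < D" "0 < \<rho>"
  shows "\<forall>\<^sub>F a in at_top. (2 * K * a / a powr - \<beta> + 1) / a \<le> a powr \<beta> * ln a"
    and "\<forall>\<^sub>F a in at_top. 2 * D * (D / (\<delta> * a)) \<le> 1"
    and "\<forall>\<^sub>F a in at_top. 2 * D * (D / \<delta> * a powr - \<rho>) \<le> 1"
  using assms by real_asymp+

section \<open>Pareto fields have an isolated peak\<close>

lemma card_lattice_box:
  "finite {z :: int ^ 'd::finite. \<forall>i. lo \<le> z $ i \<and> z $ i \<le> hi}"
  "card {z :: int ^ 'd::finite. \<forall>i. lo \<le> z $ i \<and> z $ i \<le> hi} = nat (hi - lo + 1) ^ CARD('d)"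
proof -
  let ?S = "{z :: int ^ 'd. \<forall>i. lo \<le> z $ i \<and> z $ i \<le> hi}"
  have bij: "bij_betw vec_nth ?S (PiE UNIV (\<lambda>_. {lo..hi}))"
    unfolding bij_betw_def
  proof
    show "inj_on vec_nth ?S" by (simp add: inj_on_def vec_nth_inject)
    show "vec_nth ` ?S = PiE UNIV (\<lambda>_. {lo..hi})"
    proof (intro equalityI subsetI)
      fix f :: "'d \<Rightarrow> int" assume "f \<in> PiE UNIV (\<lambda>_. {lo..hi})"
      then have "vec_lambda f \<in> ?S" "f = vec_nth (vec_lambda f)" by (auto simp: PiE_iff)
      then show "f \<in> vec_nth ` ?S" by (rule rev_image_eqI)
    qed (auto simp: PiE_iff)
  qed
  have "finite (PiE (UNIV :: 'd set) (\<lambda>_. {lo..hi}))" by (intro finite_PiE) simp_all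
  then show "finite ?S" using bij_betw_finite[OF bij] by simp
  show "card ?S = nat (hi - lo + 1) ^ CARD('d)"
    using bij_betw_same_card[OF bij] by (simp add: card_PiE)
qed

lemma card_l1_ball_le: "card {z :: int ^ 'd::finite. l1 z \<le> n} \<le> (2 * n + 1) ^ CARD('d)"
proof -
  let ?S = "{z :: int ^ 'd. \<forall>i. - int n \<le> z $ i \<and> z $ i \<le> int n}"
  have "{z :: int ^ 'd. l1 z \<le> n} \<subseteq> ?S"
  proof
    fix z :: "int ^ 'd" assume "z \<in> {z. l1 z \<le> n}"
    then have "int (l1 z) \<le> int n" by simp
    moreover have "\<bar>z $ i\<bar> \<le> int (l1 z)" for i
      unfolding int_l1 by (rule member_le_sum) auto
    ultimately have "\<bar>z $ i\<bar> \<le> int n" for i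
      using order_trans by blast
    then show "z \<in> ?S" by (auto simp: abs_le_iff minus_le_iff)
  qed
  then have "card {z :: int ^ 'd. l1 z \<le> n} \<le> card ?S"
    by (intro card_mono card_lattice_box)
  also have "\<dots> = (2 * n + 1) ^ CARD('d)" by (simp add: card_lattice_box nat_add_distrib nat_mult_distrib)
  finally show ?thesis .
qed

locale pareto_field = prob_space M for M :: "'w measure" +
  fixes \<alpha> d :: real and \<xi> :: "int ^ 'd::finite \<Rightarrow> 'w \<Rightarrow> real"
  assumes d_def: "d = real CARD('d)" and \<alpha>: "\<alpha> > d"
    and indep: "indep_vars (\<lambda>_. borel) \<xi> UNIV"
    and cdf: "1 \<le> x \<Longrightarrow> measure M {\<omega> \<in> space M. \<xi> z \<omega> \<le> x} = 1 - x powr (- \<alpha>)"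
begin

lemma d_ge_1: "1 \<le> d" unfolding d_def by (simp add: Suc_leI)

lemma \<xi>_measurable [measurable]: "\<xi> z \<in> borel_measurable M"
  using indep by (auto simp: indep_vars_def)

lemma tail:
  assumes "1 \<le> x"
  shows "prob {\<omega> \<in> space M. x < \<xi> z \<omega>} = x powr - \<alpha>"
proof -
  have "prob {\<omega> \<in> space M. \<not> \<xi> z \<omega> \<le> x} = 1 - prob {\<omega> \<in> space M. \<xi> z \<omega> \<le> x}"
    by (rule prob_neg) measurable
  then show ?thesis using cdf[OF assms] by (simp add: not_le)
qed

lemma prob_interval_le:
  assumes "1 \<le> x" "x \<le> y"
  shows "prob {\<omega> \<in> space M. x < \<xi> z \<omega> \<and> \<xi> z \<omega> \<le> y} \<le> \<alpha> * x powr (- \<alpha> - 1) * (y - x)"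
proof (cases "x = y")
  case False
  then have xy: "x < y" using assms by simp
  have "prob {\<omega> \<in> space M. x < \<xi> z \<omega> \<and> \<xi> z \<omega> \<le> y}
      = prob ({\<omega> \<in> space M. \<xi> z \<omega> \<le> y} - {\<omega> \<in> space M. \<xi> z \<omega> \<le> x})"
    by (rule arg_cong[where f = prob]) auto
  also have "\<dots> = prob {\<omega> \<in> space M. \<xi> z \<omega> \<le> y} - prob {\<omega> \<in> space M. \<xi> z \<omega> \<le> x}"
    using assms by (intro finite_measure_Diff) auto
  also have "\<dots> = x powr - \<alpha> - y powr - \<alpha>" using cdf assms by simp
  finally have 1: "prob {\<omega> \<in> space M. x < \<xi> z \<omega> \<and> \<xi> z \<omega> \<le> y} = x powr - \<alpha> - y powr - \<alpha>" .
  have "\<exists>c. x < c \<and> c < y \<and> y powr - \<alpha> - x powr - \<alpha> = (y - x) * (- \<alpha> * c powr (- \<alpha> - 1))"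
    by (rule MVT2[OF xy]) (use assms in \<open>auto intro!: derivative_eq_intros\<close>)
  then obtain c where c: "x < c" "y powr - \<alpha> - x powr - \<alpha> = (y - x) * (- \<alpha> * c powr (- \<alpha> - 1))" by blast
  have "c powr (- \<alpha> - 1) \<le> x powr (- \<alpha> - 1)"
    using c assms \<alpha> d_ge_1 by (intro powr_mono2') auto
  then have "\<alpha> * c powr (- \<alpha> - 1) * (y - x) \<le> \<alpha> * x powr (- \<alpha> - 1) * (y - x)"
    using \<alpha> d_ge_1 xy by (intro mult_right_mono mult_left_mono) auto
  then show ?thesis using 1 c(2) by (simp add: algebra_simps)
next
  case True
  then have empty: "{\<omega> \<in> space M. x < \<xi> z \<omega> \<and> \<xi> z \<omega> \<le> y} = {}" by auto
  show ?thesis unfolding empty using True by simp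
qed

lemma AE_\<xi>_nonneg: "AE \<omega> in M. \<forall>z. 0 \<le> \<xi> z \<omega>"
proof -
  have "AE \<omega> in M. 0 \<le> \<xi> z \<omega>" for z
  proof -
    have "prob {\<omega> \<in> space M. \<xi> z \<omega> \<le> 1} = 0" using cdf[of 1 z] by simp
    then have "AE \<omega> in M. \<not> \<xi> z \<omega> \<le> 1"
      by (subst AE_iff_measurable[OF _ refl]) (auto simp: emeasure_eq_measure)
    then show ?thesis by eventually_elim auto
  qed
  then show ?thesis by (simp add: AE_all_countable)
qed

text \<open>
  The height scale \<open>a\<close> determines the cost per unit of distance and the distance of the peak; a ball of that radius
  contains of the order of \<open>a powr \<alpha>\<close> sites, so that its largest value of the field has order \<open>a\<close>.
\<close>

definition "slope a = a powr - ((\<alpha> - d) / d)"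

definition "radius a = a powr (\<alpha> / d)"

lemma scales:
  assumes "1 \<le> a"
  shows "0 < slope a" "1 \<le> radius a" "slope a * radius a = a" "radius a powr d = a powr \<alpha>"
proof -
  have "1 \<le> a powr (\<alpha> / d)" using assms \<alpha> d_ge_1 by (intro ge_one_powr_ge_zero) auto
  then show "0 < slope a" "1 \<le> radius a" using assms by (auto simp: slope_def radius_def)
  have "slope a * radius a = a powr 1"
    unfolding slope_def radius_def powr_add[symmetric] using d_ge_1 by (simp add: field_simps)
  then show "slope a * radius a = a" using assms by simp
  show "radius a powr d = a powr \<alpha>" using d_ge_1 by (simp add: radius_def powr_powr)
qed

text \<open>
  One dyadic shell: the number of sites is about \<open>(2 ^ j * r) powr d\<close>, and each of them exceeds the
  level of the shell with probability of order \<open>(a * (K + 2 ^ j)) powr - \<alpha>\<close>. The powers of \<open>a\<close> cancel, and the excess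
  \<open>\<alpha> - d\<close> is split evenly between decay in \<open>K\<close> and decay in \<open>j\<close>.
\<close>

lemma envelope_shell:
  assumes "1 \<le> K" "2 \<le> a" "n = nat \<lceil>radius a\<rceil>"
  shows "prob (\<Union>z\<in>{z. l1 z \<le> 2 ^ j * n}. {\<omega> \<in> space M. a * (K + 2 ^ j) / 4 < \<xi> z \<omega>})
    \<le> 5 powr d * 4 powr \<alpha> * K powr - ((\<alpha> - d) / 2) * (2 powr - ((\<alpha> - d) / 2)) ^ j"
proof -
  let ?S = "{z :: int ^ 'd. l1 z \<le> 2 ^ j * n}"
  define r where "r = radius a"
  have r: "1 \<le> r" "r powr d = a powr \<alpha>" using scales assms by (auto simp: r_def)
  have "(1::real) \<le> 2 ^ j" by simp
  then have "2 \<le> K + 2 ^ j" using assms(1) by linarith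
  then have x: "1 \<le> a * (K + 2 ^ j) / 4"
    using mult_mono[of 2 a 2 "K + 2 ^ j"] assms by simp
  have "real n \<le> r + 1" using assms(3) r(1) unfolding r_def by linarith
  then have "real n \<le> 2 * r" using r(1) by simp
  then have "2 * (2 ^ j * real n) + 1 \<le> 2 * (2 ^ j * (2 * r)) + 2 ^ j * r"
    using r(1) mult_mono[of 1 "2 ^ j" 1 r] by (intro add_mono mult_left_mono) auto
  then have n: "2 * (2 ^ j * real n) + 1 \<le> 5 * (2 ^ j * r)" by linarith
  have "real (card ?S) \<le> real ((2 * (2 ^ j * n) + 1) ^ CARD('d))"
    using card_l1_ball_le[where n = "2 ^ j * n" and 'd = 'd] by (simp only: of_nat_le_iff)
  also have "\<dots> = (2 * (2 ^ j * real n) + 1) powr d"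
    unfolding d_def by (subst powr_realpow) (auto simp: add.commute intro: add_pos_nonneg)
  also have "\<dots> \<le> (5 * (2 ^ j * r)) powr d" using n d_ge_1 by (intro powr_mono2) auto
  also have "\<dots> = 5 powr d * ((2 ^ j) powr d * a powr \<alpha>)" using r by (simp add: powr_mult)
  finally have card: "real (card ?S) \<le> 5 powr d * ((2 ^ j) powr d * a powr \<alpha>)" .
  have "prob (\<Union>z\<in>?S. {\<omega> \<in> space M. a * (K + 2 ^ j) / 4 < \<xi> z \<omega>})
     \<le> (\<Sum>z\<in>?S. prob {\<omega> \<in> space M. a * (K + 2 ^ j) / 4 < \<xi> z \<omega>})"
    by (intro finite_measure_subadditive_finite finite_l1_ball) auto
  also have "\<dots> = real (card ?S) * (a * (K + 2 ^ j) / 4) powr - \<alpha>"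
    using tail[OF x] by simp
  also have "\<dots> \<le> (5 powr d * ((2 ^ j) powr d * a powr \<alpha>)) * (a * (K + 2 ^ j) / 4) powr - \<alpha>"
    using card by (intro mult_right_mono) auto
  also have "(a * (K + 2 ^ j) / 4) powr - \<alpha> = a powr - \<alpha> * (K + 2 ^ j) powr - \<alpha> * 4 powr \<alpha>"
    using assms by (simp add: powr_mult powr_divide powr_minus_divide)
  also have "(5 powr d * ((2 ^ j) powr d * a powr \<alpha>)) * (a powr - \<alpha> * (K + 2 ^ j) powr - \<alpha> * 4 powr \<alpha>)
     = 5 powr d * 4 powr \<alpha> * ((2 ^ j) powr d * (K + 2 ^ j) powr - \<alpha>)"
    using assms by (simp add: powr_minus field_simps)
  also have "\<dots> \<le> 5 powr d * 4 powr \<alpha> * (K powr - ((\<alpha> - d) / 2) * (2 ^ j) powr - ((\<alpha> - d) / 2))"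
  proof (rule mult_left_mono)
    have "(K + 2 ^ j) powr - \<alpha> = (K + 2 ^ j) powr - ((\<alpha> - d) / 2) * (K + 2 ^ j) powr - ((\<alpha> + d) / 2)"
      by (simp add: powr_add[symmetric] field_simps)
    also have "\<dots> \<le> K powr - ((\<alpha> - d) / 2) * (2 ^ j) powr - ((\<alpha> + d) / 2)"
      using assms \<alpha> d_ge_1 by (intro mult_mono powr_mono2') auto
    finally have "(2 ^ j) powr d * (K + 2 ^ j) powr - \<alpha>
      \<le> (2 ^ j) powr d * (K powr - ((\<alpha> - d) / 2) * (2 ^ j) powr - ((\<alpha> + d) / 2))"
      by (intro mult_left_mono) auto
    also have "\<dots> = K powr - ((\<alpha> - d) / 2) * ((2 ^ j) powr d * (2 ^ j) powr - ((\<alpha> + d) / 2))" by simp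
    also have "(2 ^ j) powr d * (2 ^ j) powr - ((\<alpha> + d) / 2) = (2 ^ j :: real) powr - ((\<alpha> - d) / 2)"
      unfolding powr_add[symmetric] by (rule arg_cong[where f = "\<lambda>x. (2 ^ j) powr x"]) (simp add: field_simps)
    finally show "(2 ^ j) powr d * (K + 2 ^ j) powr - \<alpha> \<le> K powr - ((\<alpha> - d) / 2) * (2 ^ j) powr - ((\<alpha> - d) / 2)" .
  qed auto
  also have "(2 ^ j :: real) powr - ((\<alpha> - d) / 2) = (2 powr - ((\<alpha> - d) / 2)) ^ j"
    by (simp add: powr_realpow[symmetric] powr_powr mult.commute)
  finally show ?thesis by (simp add: mult.assoc)
qed

definition "envelope_failure K a = {\<omega> \<in> space M. \<exists>z. K * a + slope a / 2 * real (l1 z) < \<xi> z \<omega>}"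

definition "envelope_const = 5 powr d * 4 powr \<alpha> / (1 - 2 powr - ((\<alpha> - d) / 2))"

lemma envelope_failure_measurable [measurable]: "envelope_failure K a \<in> sets M"
  unfolding envelope_failure_def by measurable

text \<open>
  A site violating the envelope lies in some dyadic shell, whose level is chosen below the envelope
  on that shell. The shells therefore cover the event, and their probabilities form a geometric series.
\<close>

lemma prob_envelope_failure_le:
  assumes "1 \<le> K" "2 \<le> a"
  shows "prob (envelope_failure K a) \<le> envelope_const * K powr - ((\<alpha> - d) / 2)"
proof -
  define n where "n = nat \<lceil>radius a\<rceil>"
  define F where "F j = (\<Union>z\<in>{z. l1 z \<le> 2 ^ j * n}. {\<omega> \<in> space M. a * (K + 2 ^ j) / 4 < \<xi> z \<omega>})" for j
  define c where "c = 5 powr d * 4 powr \<alpha> * K powr - ((\<alpha> - d) / 2)"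
  define q where "q = (2 :: real) powr - ((\<alpha> - d) / 2)"
  have "q < 2 powr 0" unfolding q_def using \<alpha> by (intro powr_less_mono) auto
  then have q: "0 \<le> q" "q < 1" by (auto simp: q_def)
  have r: "1 \<le> radius a" "slope a * radius a = a" "0 < slope a" using scales assms by auto
  have n: "radius a \<le> real n" "1 \<le> n" using r(1) unfolding n_def by linarith+
  have F: "F j \<in> sets M" for j
    unfolding F_def using finite_l1_ball by (intro sets.finite_UN) auto
  have pF: "prob (F j) \<le> c * q ^ j" for j
    unfolding F_def c_def q_def by (rule envelope_shell[OF assms n_def])
  have sm: "summable (\<lambda>j. c * q ^ j)" using q by (intro summable_mult summable_geometric) auto
  have sF: "summable (\<lambda>j. prob (F j))"
    by (rule summable_comparison_test'[OF sm, of 0]) (use pF in auto)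
  have "envelope_failure K a \<subseteq> (\<Union>j. F j)"
  proof
    fix \<omega> assume "\<omega> \<in> envelope_failure K a"
    then obtain z where \<omega>: "\<omega> \<in> space M" and z: "K * a + slope a / 2 * real (l1 z) < \<xi> z \<omega>"
      by (auto simp: envelope_failure_def)
    define j where "j = (LEAST j. l1 z \<le> 2 ^ j * n)"
    have "l1 z \<le> 2 ^ l1 z * n" using n(2) less_exp[of "l1 z"]
      by (metis less_imp_le mult.right_neutral mult_le_mono)
    then have j: "l1 z \<le> 2 ^ j * n" unfolding j_def by (rule LeastI)
    have "a * (K + 2 ^ j) / 4 \<le> K * a + slope a / 2 * real (l1 z)"
    proof (cases j)
      case 0
      have "a * (K + 1) / 4 \<le> K * a" using assms by (simp add: field_simps)
      moreover have "0 \<le> slope a / 2 * real (l1 z)" using r by simp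
      ultimately have "a * (K + 1) / 4 \<le> K * a + slope a / 2 * real (l1 z)" by linarith
      then show ?thesis using 0 by simp
    next
      case (Suc i)
      then have "i < (LEAST j. l1 z \<le> 2 ^ j * n)" by (simp add: j_def[symmetric])
      then have "\<not> l1 z \<le> 2 ^ i * n" by (rule not_less_Least)
      then have "real (2 ^ i * n) \<le> real (l1 z)" by (intro of_nat_mono) simp
      then have "2 ^ i * real n \<le> real (l1 z)" by simp
      moreover have "2 ^ i * radius a \<le> 2 ^ i * real n" using n(1) by (intro mult_left_mono) auto
      ultimately have "2 ^ i * radius a \<le> real (l1 z)" by linarith
      then have "slope a / 2 * (2 ^ i * radius a) \<le> slope a / 2 * real (l1 z)"
        using r by (intro mult_left_mono) auto
      also have "slope a / 2 * (2 ^ i * radius a) = a * 2 ^ i / 2" using r(2) by (simp add: field_simps)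
      finally have "a * 2 ^ i / 2 \<le> slope a / 2 * real (l1 z)" .
      moreover have "a * K / 4 \<le> K * a" using assms by (simp add: field_simps)
      moreover have "a * (K + 2 ^ j) / 4 = a * K / 4 + a * 2 ^ i / 2" using Suc by (simp add: field_simps)
      ultimately show ?thesis by linarith
    qed
    then have "a * (K + 2 ^ j) / 4 < \<xi> z \<omega>" using z by linarith
    then have "\<omega> \<in> F j" unfolding F_def using \<omega> j by blast
    then show "\<omega> \<in> (\<Union>j. F j)" by blast
  qed
  then have "prob (envelope_failure K a) \<le> prob (\<Union>j. F j)"
    using F by (intro finite_measure_mono sets.countable_UN) auto
  also have "\<dots> \<le> (\<Sum>j. prob (F j))"
    using F sF by (intro finite_measure_subadditive_countably) auto
  also have "\<dots> \<le> (\<Sum>j. c * q ^ j)" by (intro suminf_le pF sF sm)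
  also have "\<dots> = c / (1 - q)" using q by (simp add: suminf_mult suminf_geometric divide_inverse)
  also have "\<dots> = envelope_const * K powr - ((\<alpha> - d) / 2)"
    by (simp add: c_def q_def envelope_const_def)
  finally show ?thesis .
qed

definition "no_high_peak c a = {\<omega> \<in> space M. \<forall>z. \<xi> z \<omega> - slope a * real (l1 z) \<le> c * a}"

lemma no_high_peak_measurable [measurable]: "no_high_peak c a \<in> sets M"
  unfolding no_high_peak_def by measurable

text \<open>
  Within distance \<open>c * radius a\<close> the distance term costs at most \<open>c * a\<close>, so it is enough that one of the values there
  exceeds \<open>2 * c * a\<close>. A cube of side \<open>c * radius a / d\<close> fits into that ball, and by independence
  the probability that all its values are low is exponentially small in the expected number of exceedances. This
  number is of order \<open>c powr (d - \<alpha>)\<close>, which is large for small \<open>c\<close>.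
\<close>

lemma prob_no_high_peak_le:
  assumes "0 < c" "1 \<le> a" "1 \<le> 2 * c * a"
  shows "prob (no_high_peak c a) \<le> exp (- ((c / d) powr d * (2 * c) powr - \<alpha>))"
proof -
  define k where "k = \<lfloor>c * radius a / d\<rfloor>"
  define Q where "Q = {z :: int ^ 'd. \<forall>i. 0 \<le> z $ i \<and> z $ i \<le> k}"
  have r: "1 \<le> radius a" "slope a * radius a = a" "0 < slope a" "radius a powr d = a powr \<alpha>" using scales assms by auto
  have "0 \<le> c * radius a / d" using assms r d_ge_1 by simp
  then have k: "0 \<le> k" "c * radius a / d \<le> real_of_int (k + 1)" "real_of_int k \<le> c * radius a / d"
    unfolding k_def by linarith+
  have Q: "finite Q" "card Q = nat (k + 1) ^ CARD('d)" "0 \<in> Q"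
    using card_lattice_box[where lo = 0 and hi = k and 'd = 'd] k(1) by (auto simp: Q_def)
  have cardQ: "(c / d) powr d * a powr \<alpha> \<le> real (card Q)"
  proof -
    have "(c / d) powr d * a powr \<alpha> = (c * radius a / d) powr d"
      using r assms d_ge_1 by (simp add: powr_mult powr_divide flip: r(4))
    also have "\<dots> \<le> real_of_int (k + 1) powr d"
      using k(2) \<open>0 \<le> c * radius a / d\<close> d_ge_1 by (intro powr_mono2) auto
    also have "\<dots> = real (card Q)" unfolding Q(2) d_def using k(1) by (subst powr_realpow) auto
    finally show ?thesis .
  qed
  have near: "slope a * real (l1 z) \<le> c * a" if "z \<in> Q" for z
  proof -
    have "int (l1 z) \<le> (\<Sum>i\<in>(UNIV :: 'd set). k)"
      unfolding int_l1 using that by (intro sum_mono) (auto simp: Q_def)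
    then have "int (l1 z) \<le> int CARD('d) * k" by simp
    then have "real (l1 z) \<le> d * real_of_int k"
      unfolding d_def by (metis of_int_le_iff of_int_mult of_int_of_nat_eq)
    also have "\<dots> \<le> d * (c * radius a / d)" using k(3) d_ge_1 by (intro mult_left_mono) auto
    also have "\<dots> = c * radius a" using d_ge_1 by simp
    finally have "slope a * real (l1 z) \<le> slope a * (c * radius a)" using r by (intro mult_left_mono) auto
    also have "\<dots> = c * a" using r(2) by (simp add: mult.left_commute)
    finally show ?thesis .
  qed
  let ?p = "(2 * c * a) powr - \<alpha>"
  have "?p \<le> 1" using powr_mono2'[of "- \<alpha>" 1 "2 * c * a"] assms(3) \<alpha> d_ge_1 by simp
  have "no_high_peak c a \<subseteq> (\<Inter>z\<in>Q. \<xi> z -` {..2 * c * a} \<inter> space M)"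
  proof
    fix \<omega> assume \<omega>: "\<omega> \<in> no_high_peak c a"
    have "\<xi> z \<omega> \<le> 2 * c * a" if "z \<in> Q" for z
    proof -
      have "\<xi> z \<omega> - slope a * real (l1 z) \<le> c * a" using \<omega> by (simp add: no_high_peak_def)
      then show ?thesis using near[OF that] by linarith
    qed
    then show "\<omega> \<in> (\<Inter>z\<in>Q. \<xi> z -` {..2 * c * a} \<inter> space M)" using \<omega> by (auto simp: no_high_peak_def)
  qed
  then have "prob (no_high_peak c a) \<le> prob (\<Inter>z\<in>Q. \<xi> z -` {..2 * c * a} \<inter> space M)"
    using Q by (intro finite_measure_mono sets.finite_INT) auto
  also have "\<dots> = (\<Prod>z\<in>Q. prob (\<xi> z -` {..2 * c * a} \<inter> space M))"
    using Q by (intro indep_varsD[OF indep]) auto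
  also have "\<dots> = (1 - ?p) ^ card Q"
  proof -
    have "\<xi> z -` {..2 * c * a} \<inter> space M = {\<omega> \<in> space M. \<xi> z \<omega> \<le> 2 * c * a}" for z by auto
    then show ?thesis using cdf[OF assms(3)] by simp
  qed
  also have "\<dots> \<le> exp (- ?p) ^ card Q"
    using \<open>?p \<le> 1\<close> exp_ge_add_one_self[of "- ?p"] by (intro power_mono) auto
  also have "\<dots> = exp (- (real (card Q) * ?p))" by (simp add: exp_of_nat_mult[symmetric])
  also have "\<dots> \<le> exp (- (((c / d) powr d * a powr \<alpha>) * ?p))"
    using mult_right_mono[OF cardQ, of ?p] by simp
  also have "((c / d) powr d * a powr \<alpha>) * ?p = (c / d) powr d * (2 * c) powr - \<alpha>"
    using assms by (simp add: powr_mult powr_minus field_simps)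
  finally show ?thesis .
qed

text \<open>
  Windows of width \<open>2 * h\<close> that overlap by \<open>h\<close>: two positive values at distance less than \<open>h\<close> always lie in a common window. This
  reduces closeness of two independent values to finitely many product events.
\<close>

definition "window h a j z = {\<omega> \<in> space M.
  (real j - 1) * h < \<xi> z \<omega> - slope a * real (l1 z) \<and> \<xi> z \<omega> - slope a * real (l1 z) \<le> (real j + 1) * h}"

text \<open>
  Pairs of distinct relevant sites, and only windows at heights between \<open>c * a / 2\<close> and about \<open>2 * K * a\<close>,
  so that the density of the Pareto law is of order \<open>a powr (- \<alpha> - 1)\<close> there.
\<close>

definition "close_pair K c \<delta> a =
  (\<Union>(z, y) \<in> {z. real (l1 z) \<le> 2 * K * radius a} \<times> {z. real (l1 z) \<le> 2 * K * radius a} - Id.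
   \<Union>j \<in> {j. c * a / 2 \<le> (real j - 1) * (9 * \<delta> * a) \<and> real j * (9 * \<delta> * a) \<le> 2 * K * a}.
     window (9 * \<delta> * a) a j z \<inter> window (9 * \<delta> * a) a j y)"

lemma window_measurable [measurable]: "window h a j z \<in> sets M"
  unfolding window_def by measurable

lemma prob_window_le:
  assumes "1 \<le> a" "0 < h" "1 \<le> b" "b \<le> (real j - 1) * h"
  shows "prob (window h a j z) \<le> \<alpha> * b powr (- \<alpha> - 1) * (2 * h)"
proof -
  let ?x = "slope a * real (l1 z) + (real j - 1) * h"
  let ?y = "slope a * real (l1 z) + (real j + 1) * h"
  have "0 \<le> slope a * real (l1 z)" using scales(1)[OF assms(1)] by simp
  then have x: "b \<le> ?x" using assms by linarith
  have xy: "?y - ?x = 2 * h" by (simp add: algebra_simps)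
  have "window h a j z = {\<omega> \<in> space M. ?x < \<xi> z \<omega> \<and> \<xi> z \<omega> \<le> ?y}"
    unfolding window_def by auto
  then have "prob (window h a j z) \<le> \<alpha> * ?x powr (- \<alpha> - 1) * (?y - ?x)"
    using prob_interval_le[of ?x ?y z] x xy assms by simp
  also have "\<dots> \<le> \<alpha> * b powr (- \<alpha> - 1) * (?y - ?x)"
    unfolding xy using x assms \<alpha> d_ge_1 by (intro mult_right_mono mult_left_mono powr_mono2') auto
  finally show ?thesis unfolding xy .
qed

lemma indep_window:
  assumes "z \<noteq> y"
  shows "prob (window h a j z \<inter> window h a j y) = prob (window h a j z) * prob (window h a j y)"
proof -
  let ?A = "\<lambda>z. {slope a * real (l1 z) + (real j - 1) * h <.. slope a * real (l1 z) + (real j + 1) * h}"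
  have w: "window h a j z = \<xi> z -` ?A z \<inter> space M" for z
    by (auto simp: window_def)
  have "prob (\<Inter>z\<in>{z, y}. \<xi> z -` ?A z \<inter> space M) = (\<Prod>z\<in>{z, y}. prob (\<xi> z -` ?A z \<inter> space M))"
    by (intro indep_varsD[OF indep]) auto
  then show ?thesis using assms by (simp add: w)
qed

definition "close_pair_bound K c \<delta> =
  (5 * K) powr (2 * d) * (2 * K / (9 * \<delta>) + 1) * (\<alpha> * (c / 2) powr (- \<alpha> - 1) * (18 * \<delta>))\<^sup>2"

text \<open>
  There are of order \<open>a powr (2 * \<alpha>)\<close> pairs and \<open>1 / \<delta>\<close> windows, and each of the two independent values lies in
  a given window with probability of order \<open>\<delta> * a powr - \<alpha>\<close>. The product is of order \<open>\<delta>\<close>, uniformly in \<open>a\<close>.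
\<close>

lemma close_pair:
  assumes "1 \<le> K" "0 < c" "0 < \<delta>" "1 \<le> a" "1 \<le> c * a / 2"
  shows "close_pair K c \<delta> a \<in> sets M" "prob (close_pair K c \<delta> a) \<le> close_pair_bound K c \<delta>"
proof -
  define h where "h = 9 * \<delta> * a"
  define B where "B = {z :: int ^ 'd. real (l1 z) \<le> 2 * K * radius a}"
  define J where "J = {j. c * a / 2 \<le> (real j - 1) * h \<and> real j * h \<le> 2 * K * a}"
  define P where "P = B \<times> B - Id"
  define n where "n = nat \<lfloor>2 * K * radius a\<rfloor>"
  have h: "0 < h" using assms by (simp add: h_def)
  have r: "1 \<le> radius a" "radius a powr d = a powr \<alpha>" using scales assms by auto
  have Kr: "1 \<le> K * radius a" using mult_mono[of 1 K 1 "radius a"] assms r by simp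
  have B_eq: "B = {z. l1 z \<le> n}" using Kr by (auto simp: B_def n_def le_nat_iff le_floor_iff)
  have fB: "finite B" unfolding B_eq by (rule finite_l1_ball)
  have n: "real n \<le> 2 * K * radius a" using Kr unfolding n_def by linarith
  have cardB: "real (card B) \<le> (5 * K) powr d * a powr \<alpha>"
  proof -
    have "real (card B) \<le> real ((2 * n + 1) ^ CARD('d))"
      unfolding B_eq using card_l1_ball_le[where n = n and 'd = 'd] by (simp only: of_nat_le_iff)
    also have "\<dots> = (2 * real n + 1) powr d"
      unfolding d_def by (subst powr_realpow) (auto simp: add.commute)
    also have "\<dots> \<le> (5 * (K * radius a)) powr d" using n Kr d_ge_1 by (intro powr_mono2) auto
    also have "\<dots> = (5 * K) powr d * a powr \<alpha>" using assms r by (simp add: powr_mult mult.assoc flip: r(2))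
    finally show ?thesis .
  qed
  have J: "finite J" "real (card J) \<le> 2 * K / (9 * \<delta>) + 1"
  proof -
    let ?N = "nat \<lfloor>2 * K / (9 * \<delta>)\<rfloor>"
    have N0: "0 \<le> 2 * K / (9 * \<delta>)" using assms by simp
    have sub: "J \<subseteq> {1..?N}"
    proof
      fix j assume j: "j \<in> J"
      then have "0 < (real j - 1) * h" using assms(5) by (auto simp: J_def)
      then have "1 < real j" using h by (simp add: zero_less_mult_iff)
      moreover have "real j * (9 * \<delta>) * a \<le> 2 * K * a" using j by (simp add: J_def h_def mult.assoc)
      then have "real j * (9 * \<delta>) \<le> 2 * K" using assms by simp
      then have "real j \<le> 2 * K / (9 * \<delta>)" using assms by (simp add: field_simps)
      ultimately show "j \<in> {1..?N}" using N0 by (auto simp: le_nat_iff le_floor_iff)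
    qed
    then show "finite J" by (rule finite_subset) simp
    have "card J \<le> ?N" using card_mono[OF _ sub] by simp
    then show "real (card J) \<le> 2 * K / (9 * \<delta>) + 1" using N0 by linarith
  qed
  define b where "b = c * a / 2"
  define w where "w = \<alpha> * b powr (- \<alpha> - 1) * (2 * h)"
  have w0: "0 \<le> w" using \<alpha> d_ge_1 h by (simp add: w_def)
  have fP: "finite P" using fB by (simp add: P_def)
  have eq: "close_pair K c \<delta> a = (\<Union>(z, y)\<in>P. \<Union>j\<in>J. window h a j z \<inter> window h a j y)"
    by (simp add: close_pair_def P_def B_def J_def h_def)
  have inner: "(\<Union>j\<in>J. window h a j z \<inter> window h a j y) \<in> sets M" for z y
    using J(1) by (intro sets.finite_UN) auto
  show "close_pair K c \<delta> a \<in> sets M"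
    unfolding eq using fP inner by (intro sets.finite_UN) auto
  have "prob (close_pair K c \<delta> a) \<le> (\<Sum>(z, y)\<in>P. prob (\<Union>j\<in>J. window h a j z \<inter> window h a j y))"
    unfolding eq case_prod_beta using fP inner by (intro finite_measure_subadditive_finite) auto
  also have "\<dots> \<le> (\<Sum>(z, y)\<in>P. real (card J) * w\<^sup>2)"
    unfolding case_prod_beta
  proof (rule sum_mono)
    fix p assume p: "p \<in> P"
    have "prob (\<Union>j\<in>J. window h a j (fst p) \<inter> window h a j (snd p))
       \<le> (\<Sum>j\<in>J. prob (window h a j (fst p) \<inter> window h a j (snd p)))"
      using J(1) by (intro finite_measure_subadditive_finite) auto
    also have "\<dots> \<le> (\<Sum>j\<in>J. w\<^sup>2)"
    proof (rule sum_mono)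
      fix j assume "j \<in> J"
      then have "prob (window h a j z) \<le> w" for z
        unfolding w_def using assms h by (intro prob_window_le) (auto simp: J_def b_def)
      then show "prob (window h a j (fst p) \<inter> window h a j (snd p)) \<le> w\<^sup>2"
        using p w0 by (subst indep_window) (auto simp: P_def power2_eq_square intro!: mult_mono)
    qed
    finally show "prob (\<Union>j\<in>J. window h a j (fst p) \<inter> window h a j (snd p)) \<le> real (card J) * w\<^sup>2" by simp
  qed
  also have "\<dots> = real (card P) * (real (card J) * w\<^sup>2)" by (simp add: case_prod_beta)
  also have "\<dots> \<le> (((5 * K) powr d * a powr \<alpha>) * ((5 * K) powr d * a powr \<alpha>)) * ((2 * K / (9 * \<delta>) + 1) * w\<^sup>2)"
  proof (intro mult_mono)
    have "real (card P) \<le> real (card (B \<times> B))"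
      unfolding P_def using fB by (intro of_nat_mono card_mono) auto
    also have "\<dots> = real (card B) * real (card B)" by (simp add: card_cartesian_product)
    also have "\<dots> \<le> ((5 * K) powr d * a powr \<alpha>) * ((5 * K) powr d * a powr \<alpha>)"
      using cardB by (intro mult_mono) auto
    finally show "real (card P) \<le> ((5 * K) powr d * a powr \<alpha>) * ((5 * K) powr d * a powr \<alpha>)" .
  qed (use J(2) assms in auto)
  also have "\<dots> = close_pair_bound K c \<delta>"
  proof -
    have "w = \<alpha> * ((c / 2) powr (- \<alpha> - 1) * a powr (- \<alpha> - 1)) * (2 * (9 * \<delta> * a))"
      using assms unfolding w_def b_def h_def by (simp add: powr_mult[symmetric])
    also have "a powr (- \<alpha> - 1) = a powr - \<alpha> / a" using assms by (simp add: powr_diff)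
    finally have "a powr \<alpha> * w = (a powr \<alpha> * a powr - \<alpha>) * (\<alpha> * (c / 2) powr (- \<alpha> - 1) * (18 * \<delta>))"
      using assms by simp
    also have "a powr \<alpha> * a powr - \<alpha> = 1" using assms by (simp flip: powr_add)
    finally have aw: "a powr \<alpha> * w = \<alpha> * (c / 2) powr (- \<alpha> - 1) * (18 * \<delta>)" by simp
    have K2: "(5 * K) powr (2 * d) = (5 * K) powr d * (5 * K) powr d"
      by (simp flip: powr_add)
    show ?thesis unfolding close_pair_bound_def aw[symmetric] K2 by (simp add: power2_eq_square algebra_simps)
  qed
  finally show "prob (close_pair K c \<delta> a) \<le> close_pair_bound K c \<delta>" .
qed

text \<open>
  The envelope makes the set of sites with \<open>\<Phi> z \<ge> 0\<close> finite, so a maximum exists as soon as there is a high site. A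
  competitor within \<open>9 * \<delta> * a\<close> of the maximum would form a close pair with it.
\<close>

lemma isolated_peak:
  assumes "1 \<le> K" "0 < c" "0 < \<delta>" "36 * \<delta> \<le> c" "1 \<le> a"
    and \<omega>: "\<omega> \<in> space M" "\<omega> \<notin> envelope_failure K a" "\<omega> \<notin> no_high_peak c a" "\<omega> \<notin> close_pair K c \<delta> a"
  obtains A where "\<And>z. z \<noteq> A \<Longrightarrow>
    \<xi> z \<omega> - slope a * real (l1 z) + 9 * \<delta> * a \<le> \<xi> A \<omega> - slope a * real (l1 A)"
proof -
  define \<Phi> where "\<Phi> z = \<xi> z \<omega> - slope a * real (l1 z)" for z
  define h where "h = 9 * \<delta> * a"
  define B where "B = {z :: int ^ 'd. real (l1 z) \<le> 2 * K * radius a}"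
  have s: "0 < slope a" "1 \<le> radius a" "slope a * radius a = a" using scales assms by auto
  have h: "0 < h" "4 * h \<le> c * a"
    using assms mult_right_mono[of "36 * \<delta>" c a] by (auto simp: h_def)
  have env: "\<xi> z \<omega> \<le> K * a + slope a / 2 * real (l1 z)" for z
    using \<omega>(1,2) by (auto simp: envelope_failure_def not_less)
  have inB: "slope a * real (l1 z) \<le> 2 * K * a" "z \<in> B" if "0 \<le> \<Phi> z" for z
  proof -
    show 1: "slope a * real (l1 z) \<le> 2 * K * a" using env[of z] that by (simp add: \<Phi>_def)
    have "2 * K * a = slope a * (2 * K * radius a)" using s(3) by (simp add: algebra_simps)
    with 1 have "slope a * real (l1 z) \<le> slope a * (2 * K * radius a)" by linarith
    then show "z \<in> B" using s(1) by (simp add: B_def)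
  qed
  obtain z0 where z0: "c * a < \<Phi> z0" using \<omega>(1,3) by (auto simp: no_high_peak_def \<Phi>_def not_le)
  define H where "H = {z. c * a < \<Phi> z}"
  have ca: "0 < c * a" using assms by simp
  have "B \<subseteq> {z. l1 z \<le> nat \<lfloor>2 * K * radius a\<rfloor>}" by (auto simp: B_def le_nat_iff le_floor_iff)
  then have fB: "finite B" using finite_l1_ball finite_subset by blast
  have "H \<subseteq> B" using inB(2) ca by (force simp: H_def)
  then have fH: "finite H" using fB finite_subset by blast
  obtain A where A: "A \<in> H" "\<And>z. z \<in> H \<Longrightarrow> \<Phi> z \<le> \<Phi> A"
  proof -
    have "Max (\<Phi> ` H) \<in> \<Phi> ` H" using fH z0 by (intro Max_in) (auto simp: H_def)
    then obtain A where "A \<in> H" "\<Phi> A = Max (\<Phi> ` H)" by auto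
    then show thesis using that[of A] fH by simp
  qed
  have max: "\<Phi> z \<le> \<Phi> A" for z
    using A by (cases "z \<in> H") (auto simp: H_def)
  have A_high: "c * a < \<Phi> A" using A by (simp add: H_def)
  have "\<Phi> z + h \<le> \<Phi> A" if zA: "z \<noteq> A" for z
  proof (rule ccontr)
    assume "\<not> \<Phi> z + h \<le> \<Phi> A"
    then have near: "\<Phi> A - h < \<Phi> z" by simp
    define j where "j = nat (\<lceil>\<Phi> A / h\<rceil> - 1)"
    have "0 < \<Phi> A / h" using A_high ca h by simp
    then have "real j < \<Phi> A / h" "\<Phi> A / h \<le> real j + 1" unfolding j_def by linarith+
    then have j: "real j * h < \<Phi> A" "\<Phi> A \<le> (real j + 1) * h" using h by (auto simp: field_simps)
    have 1: "\<omega> \<in> window h a j A" "\<omega> \<in> window h a j z"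
      using j near max[of z] \<omega>(1) h by (auto simp: window_def \<Phi>_def algebra_simps)
    have AB: "A \<in> B" "slope a * real (l1 A) \<le> 2 * K * a" using inB[of A] A_high ca by auto
    have zB: "z \<in> B" using inB(2)[of z] near A_high h by linarith
    have "\<xi> A \<omega> \<le> 2 * K * a" using env[of A] AB(2) by simp
    moreover have "0 \<le> slope a * real (l1 A)" using s by simp
    ultimately have "\<Phi> A \<le> 2 * K * a" by (simp add: \<Phi>_def)
    then have "real j * h \<le> 2 * K * a" using j by simp
    moreover have "c * a / 2 \<le> (real j - 1) * h" using j(2) A_high h by (simp add: algebra_simps)
    ultimately have "\<omega> \<in> close_pair K c \<delta> a"
      unfolding close_pair_def B_def[symmetric] h_def[symmetric] using 1 AB(1) zB zA
      by (intro UN_I[of "(A, z)"] case_prodI2) auto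
    then show False using \<omega>(4) by simp
  qed
  then show thesis using that[of A] by (simp add: \<Phi>_def h_def)
qed

end

section \<open>Convergence in probability\<close>

text \<open>
  The height \<open>a\<close> is a function of the time \<open>t\<close>; solving for it exactly makes \<open>\<kappa> * t = ln a\<close> an identity.
\<close>

lemma inverse_time_scale:
  fixes \<beta> :: real
  assumes "0 < \<beta>"
  obtains f :: "real \<Rightarrow> real" where
    "\<And>t. 0 < t \<Longrightarrow> 1 \<le> f t" "\<And>t. 0 < t \<Longrightarrow> f t powr \<beta> * ln (f t) = t" "filterlim f at_top at_top"
proof -
  define g where "g a = a powr \<beta> * ln a" for a :: real
  have lim: "filterlim g at_top at_top" unfolding g_def using assms by real_asymp
  have mono: "g a \<le> g b" if "1 \<le> a" "a \<le> b" for a b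
    unfolding g_def using that assms by (intro mult_mono powr_mono2) auto
  have "\<exists>a\<ge>1. g a = t" if "0 < t" for t
  proof -
    have "\<forall>\<^sub>F b in at_top. t \<le> g b \<and> 1 \<le> b"
      using lim by (intro eventually_conj eventually_ge_at_top) (simp add: filterlim_at_top)
    then obtain b where b: "t \<le> g b" "1 \<le> b" using eventually_happens'[OF trivial_limit_at_top_linorder] by blast
    have "continuous_on {1..b} g" unfolding g_def by (intro continuous_intros) auto
    then have "\<exists>x\<ge>1. x \<le> b \<and> g x = t"
      using b that by (intro IVT') (auto simp: g_def)
    then show ?thesis by blast
  qed
  then obtain f where f: "\<And>t. 0 < t \<Longrightarrow> 1 \<le> f t" "\<And>t. 0 < t \<Longrightarrow> g (f t) = t" by metis
  have "filterlim f at_top at_top"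
    unfolding filterlim_at_top
  proof
    fix Z :: real
    show "\<forall>\<^sub>F t in at_top. Z \<le> f t"
      using eventually_gt_at_top[of 0] eventually_gt_at_top[of "g (max Z 1)"]
    proof eventually_elim
      case (elim t)
      show ?case
      proof (rule ccontr)
        assume "\<not> Z \<le> f t"
        then have "g (f t) \<le> g (max Z 1)" using f(1)[OF elim(1)] by (intro mono) auto
        then show False using f(2)[OF elim(1)] elim(2) by simp
      qed
    qed
  qed
  then show thesis using that[of f] f unfolding g_def by blast
qed

context pareto_field begin

text \<open>
  The order of the choices matters: the bound on close pairs depends on \<open>K\<close> and \<open>c\<close>, so \<open>\<delta>\<close> comes last. None of the
  bounds involves \<open>a\<close>.
\<close>

lemma failure_parameters:
  assumes "0 < e"
  obtains K c \<delta> where "1 \<le> K" "0 < c" "0 < \<delta>" "36 * \<delta> \<le> c"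
    "envelope_const * K powr - ((\<alpha> - d) / 2) \<le> e / 3"
    "exp (- ((c / d) powr d * (2 * c) powr - \<alpha>)) \<le> e / 3"
    "close_pair_bound K c \<delta> \<le> e / 3"
proof -
  have e: "0 < e / 3" using assms by simp
  have d0: "0 < d" "0 < \<alpha> - d" using d_ge_1 \<alpha> by auto
  have limK: "((\<lambda>K. envelope_const * K powr - ((\<alpha> - d) / 2)) \<longlongrightarrow> 0) at_top"
    using d0 by (intro tendsto_mult_right_zero tendsto_neg_powr filterlim_ident) auto
  have "\<forall>\<^sub>F K in at_top. 1 \<le> K \<and> envelope_const * K powr - ((\<alpha> - d) / 2) < e / 3"
    by (intro eventually_conj eventually_ge_at_top order_tendstoD(2)[OF limK e])
  then obtain K where K: "1 \<le> K" "envelope_const * K powr - ((\<alpha> - d) / 2) < e / 3"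
    using eventually_happens'[OF trivial_limit_at_top_linorder] by blast
  have limc: "((\<lambda>c. exp (- ((c / d) powr d * (2 * c) powr - \<alpha>))) \<longlongrightarrow> 0) (at_right 0)"
    using d0 by real_asymp
  have "\<forall>\<^sub>F c in at_right 0. 0 < c \<and> exp (- ((c / d) powr d * (2 * c) powr - \<alpha>)) < e / 3"
    by (intro eventually_conj eventually_at_right_less order_tendstoD(2)[OF limc e])
  then obtain c where c: "0 < c" "exp (- ((c / d) powr d * (2 * c) powr - \<alpha>)) < e / 3"
    using eventually_happens'[OF trivial_limit_at_right_real] by blast
  define x where "x = (5 * K) powr (2 * d)"
  define y where "y = \<alpha> * (c / 2) powr (- \<alpha> - 1)"
  have "((\<lambda>\<delta>. x * (2 * K / (9 * \<delta>) + 1) * (y * (18 * \<delta>))\<^sup>2) \<longlongrightarrow> 0) (at_right 0)"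
  proof -
    have "0 < x" "0 < y" "0 < K" using K(1) c(1) d0 by (auto simp: x_def y_def)
    then show ?thesis by real_asymp
  qed
  then have lim\<delta>: "((\<lambda>\<delta>. close_pair_bound K c \<delta>) \<longlongrightarrow> 0) (at_right 0)"
    unfolding close_pair_bound_def x_def y_def .
  have "\<forall>\<^sub>F \<delta> in at_right 0. \<delta> \<in> {0<..<c / 36} \<and> close_pair_bound K c \<delta> < e / 3"
    using c(1) by (intro eventually_conj eventually_at_right_real order_tendstoD(2)[OF lim\<delta> e]) auto
  then obtain \<delta> where \<delta>: "\<delta> \<in> {0<..<c / 36}" "close_pair_bound K c \<delta> < e / 3"
    using eventually_happens'[OF trivial_limit_at_right_real] by blast
  show thesis by (rule that[of K c \<delta>]) (use K c \<delta> in auto)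
qed

text \<open>
  For each large \<open>t\<close> the deviation event is contained in the union of a null set and the three failure
  events at height \<open>a = f t\<close>, on the complement of which the deterministic estimate applies to the single realisation. The
  union is measurable and bounds the outer measure.
\<close>

lemma solution_concentrates:
  assumes sol: "AE \<omega> in M. nonneg_pam_solution (\<lambda>z. \<xi> z \<omega>) (\<lambda>t z. u t z \<omega>)"
  obtains Z :: "real \<Rightarrow> 'w \<Rightarrow> int ^ 'd" where
    "\<And>t. Z t \<in> measurable M (count_space UNIV)"
    "converges_in_prob M (\<lambda>t \<omega>. u t (Z t \<omega>) \<omega> / total_mass (\<lambda>z. u t z \<omega>)) 1 at_top"
proof -
  define \<beta> where "\<beta> = (\<alpha> - d) / d"
  have \<beta>: "0 < \<beta>" using \<alpha> d_ge_1 by (simp add: \<beta>_def)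
  obtain f where f: "\<And>t. 0 < t \<Longrightarrow> 1 \<le> f t" "\<And>t. 0 < t \<Longrightarrow> f t powr \<beta> * ln (f t) = t" "filterlim f at_top at_top"
    by (rule inverse_time_scale[OF \<beta>]) blast
  define peak where "peak t A \<omega> \<longleftrightarrow> (\<forall>z. z \<noteq> A \<longrightarrow>
    \<xi> z \<omega> - slope (f t) * real (l1 z) < \<xi> A \<omega> - slope (f t) * real (l1 A))" for t A \<omega>
  define Z where "Z t \<omega> = (THE A. peak t A \<omega>)" for t \<omega>
  have peak_unique: "A = B" if "peak t A \<omega>" "peak t B \<omega>" for t A B \<omega>
    using that unfolding peak_def by (metis less_asym)
  have peak_meas [measurable]: "Measurable.pred M (peak t A)" for t A
    unfolding peak_def by measurable
  have Z_meas: "Z t \<in> measurable M (count_space UNIV)" for t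
    unfolding Z_def by (rule measurable_THE) (use peak_unique in auto)
  have "AE \<omega> in M. nonneg_pam_solution (\<lambda>z. \<xi> z \<omega>) (\<lambda>t z. u t z \<omega>) \<and> (\<forall>z. 0 \<le> \<xi> z \<omega>)"
    using sol AE_\<xi>_nonneg by eventually_elim auto
  then obtain N where N: "N \<in> null_sets M"
    "\<And>\<omega>. \<omega> \<in> space M - N \<Longrightarrow> nonneg_pam_solution (\<lambda>z. \<xi> z \<omega>) (\<lambda>t z. u t z \<omega>) \<and> (\<forall>z. 0 \<le> \<xi> z \<omega>)"
    by (rule AE_E3) blast
  define X where "X t \<omega> = u t (Z t \<omega>) \<omega> / total_mass (\<lambda>z. u t z \<omega>)" for t \<omega>
  have bound: "\<forall>\<^sub>F t in at_top. outer_measure_of M {\<omega> \<in> space M. \<epsilon> < \<bar>X t \<omega> - 1\<bar>} \<le> ennreal e"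
    if "0 < \<epsilon>" "0 < e" for \<epsilon> e
  proof -
    obtain K c \<delta> where par: "1 \<le> K" "0 < c" "0 < \<delta>" "36 * \<delta> \<le> c"
      "envelope_const * K powr - ((\<alpha> - d) / 2) \<le> e / 3"
      "exp (- ((c / d) powr d * (2 * c) powr - \<alpha>)) \<le> e / 3"
      "close_pair_bound K c \<delta> \<le> e / 3"
      using failure_parameters[OF \<open>0 < e\<close>] .
    define D where "D = 2 * d"
    define \<rho> where "\<rho> = \<delta> / (2 * (9 * \<delta> + K))"
    have pos: "0 < K" "0 < D" "0 < \<rho>" using par d_ge_1 by (auto simp: D_def \<rho>_def)
    have "\<forall>\<^sub>F a in at_top. 2 \<le> a \<and> 2 / c \<le> a \<and>
      (2 * K * a / a powr - \<beta> + 1) / a \<le> a powr \<beta> * ln a \<and>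
      2 * D * (D / (\<delta> * a)) \<le> 1 \<and> 2 * D * (D / \<delta> * a powr - \<rho>) \<le> 1 \<and>
      2 * D * (D / (\<delta> * a)) + 4 * exp (2 * K * (2 * K * a / a powr - \<beta> + 1) + D * (a powr \<beta> * ln a)
        - 3 * \<delta> * a * (a powr \<beta> * ln a)) < \<epsilon>"
      by (intro eventually_conj eventually_ge_at_top
          eventually_early_and_small[OF \<beta> par(3) pos(1,2,3)]
          order_tendstoD(2)[OF concentration_error_tendsto_0[OF \<beta> par(3) pos(1,2)] that(1)])
    from eventually_compose_filterlim[OF this f(3)] eventually_gt_at_top[of 0]
    show ?thesis
    proof eventually_elim
      case (elim t)
      define a where "a = f t"
      define bad where "bad = envelope_failure K a \<union> (no_high_peak c a \<union> close_pair K c \<delta> a)"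
      have t: "0 < t" and ft: "a powr \<beta> * ln a = t" using elim f(2) by (auto simp: a_def)
      have a: "2 \<le> a" "1 \<le> a" "1 \<le> c * a / 2" "1 \<le> 2 * c * a"
        and early: "(2 * K * a / slope a + 1) / a \<le> t"
        and small: "2 * D * (D / (\<delta> * a)) \<le> 1" "2 * D * (D / \<delta> * a powr - \<rho>) \<le> 1"
        and err: "2 * D * (D / (\<delta> * a)) + 4 * exp (2 * K * (2 * K * a / slope a + 1) + D * t - 3 * \<delta> * a * t) < \<epsilon>"
        using elim(1) par(2) ft by (auto simp: a_def[symmetric] slope_def \<beta>_def[symmetric] field_simps)
      have "{\<omega> \<in> space M. \<epsilon> < \<bar>X t \<omega> - 1\<bar>} \<subseteq> N \<union> bad"
      proof
        fix \<omega> assume \<omega>: "\<omega> \<in> {\<omega> \<in> space M. \<epsilon> < \<bar>X t \<omega> - 1\<bar>}"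
        show "\<omega> \<in> N \<union> bad"
        proof (rule ccontr)
          assume good: "\<omega> \<notin> N \<union> bad"
          then have "\<omega> \<in> space M - N" using \<omega> by simp
          from N(2)[OF this] interpret pam "\<lambda>z. \<xi> z \<omega>" "\<lambda>t z. u t z \<omega>" D
            by unfold_locales (auto simp: D_def d_def)
          obtain A where A: "\<And>z. z \<noteq> A \<Longrightarrow>
              \<xi> z \<omega> - slope a * real (l1 z) + 9 * \<delta> * a \<le> \<xi> A \<omega> - slope a * real (l1 A)"
            by (rule isolated_peak[OF par(1-4) a(2), of \<omega>]) (use \<omega> good in \<open>auto simp: bad_def\<close>)
          have "0 < 9 * \<delta> * a" using par a by simp
          then have "peak t A \<omega>" unfolding peak_def a_def[symmetric] using A by (smt (verit))
          then have "Z t \<omega> = A" unfolding Z_def using peak_unique by (intro the_equality) auto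
          moreover have "\<bar>u t A \<omega> / total_mass (\<lambda>z. u t z \<omega>) - 1\<bar> \<le>
              2 * D * (D / (\<delta> * a)) + 4 * exp (2 * K * (2 * K * a / slope a + 1) + D * t - 3 * \<delta> * a * t)"
          proof (rule concentration[OF t a(2) scales(1)[OF a(2)] _ par(3) pos(1) _ A early \<rho>_def small])
            have "slope a * t = (a powr - \<beta> * a powr \<beta>) * ln a"
              unfolding ft[symmetric] by (simp add: slope_def \<beta>_def)
            also have "a powr - \<beta> * a powr \<beta> = 1" using a(2) by (simp flip: powr_add)
            finally show "slope a * t = ln a" by simp
            show "\<xi> z \<omega> \<le> K * a + slope a / 2 * real (l1 z)" for z
              using \<omega> good by (auto simp: bad_def envelope_failure_def not_less)
          qed
          ultimately have "\<bar>X t \<omega> - 1\<bar> < \<epsilon>" using err by (simp add: X_def)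
          then show False using \<omega> by simp
        qed
      qed
      moreover have bad: "bad \<in> sets M" and "N \<in> sets M"
        using close_pair(1)[OF par(1-3) a(2,3)] N(1) by (auto simp: bad_def)
      ultimately have "outer_measure_of M {\<omega> \<in> space M. \<epsilon> < \<bar>X t \<omega> - 1\<bar>} \<le> emeasure M (N \<union> bad)"
        by (metis outer_measure_of_eq outer_measure_of_mono sets.Un)
      also have "\<dots> = emeasure M bad" by (subst Un_commute) (rule emeasure_Un_null_set[OF bad N(1)])
      also have "\<dots> \<le> ennreal e"
      proof -
        have "prob bad \<le> prob (envelope_failure K a) + (prob (no_high_peak c a) + prob (close_pair K c \<delta> a))"
          unfolding bad_def using close_pair(1)[OF par(1-3) a(2,3)]
          by (intro order_trans[OF measure_Un_le] add_left_mono measure_Un_le) auto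
        also have "\<dots> \<le> e / 3 + (e / 3 + e / 3)"
          using prob_envelope_failure_le[OF par(1) a(1)] prob_no_high_peak_le[OF par(2) a(2,4)]
            close_pair(2)[OF par(1-3) a(2,3)] par(5-7) by linarith
        finally show ?thesis by (simp add: emeasure_eq_measure ennreal_leI)
      qed
      finally show ?case .
    qed
  qed
  have "converges_in_prob M X 1 at_top"
    unfolding converges_in_prob_def
  proof (intro allI impI order_tendstoI)
    fix \<epsilon> :: real and y :: ennreal assume \<epsilon>: "0 < \<epsilon>" and y: "0 < y"
    obtain y' where y': "0 < y'" "y' < y" using dense[OF y] by blast
    then obtain e where e: "y' = ennreal e" "0 \<le> e" by (cases y') auto
    then have "0 < e" using y' by simp
    from bound[OF \<epsilon> this]
    show "\<forall>\<^sub>F t in at_top. outer_measure_of M {\<omega> \<in> space M. \<epsilon> < \<bar>X t \<omega> - 1\<bar>} < y"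
      by eventually_elim (use e y' in auto)
  qed auto
  then show thesis using that[of Z] Z_meas unfolding X_def by blast
qed

end

theorem theorem1:
  fixes M :: "'w measure"
    and \<alpha> :: real
    and \<xi> :: "int ^ 'd::finite \<Rightarrow> 'w \<Rightarrow> real"
    and u :: "real \<Rightarrow> int ^ 'd \<Rightarrow> 'w \<Rightarrow> real"
  assumes "prob_space M"
    and "\<alpha> > real CARD('d)"
    and "prob_space.indep_vars M (\<lambda>_. borel) \<xi> UNIV"
    and "\<And>z x. x \<ge> 1 \<Longrightarrow> measure M {\<omega> \<in> space M. \<xi> z \<omega> \<le> x} = 1 - x powr (- \<alpha>)"
    and "AE \<omega> in M. nonneg_pam_solution (\<lambda>z. \<xi> z \<omega>) (\<lambda>t z. u t z \<omega>)"
  shows "\<exists>Z :: real \<Rightarrow> 'w \<Rightarrow> int ^ 'd.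
    (\<forall>t>0. Z t \<in> measurable M (count_space UNIV)) \<and>
    converges_in_prob M (\<lambda>t \<omega>. u t (Z t \<omega>) \<omega> / total_mass (\<lambda>z. u t z \<omega>)) 1 at_top"
proof -
  interpret prob_space M by fact
  interpret pareto_field M \<alpha> "real CARD('d)" \<xi>
    by unfold_locales (use assms in auto)
  obtain Z :: "real \<Rightarrow> 'w \<Rightarrow> int ^ 'd" where "\<And>t. Z t \<in> measurable M (count_space UNIV)"
    "converges_in_prob M (\<lambda>t \<omega>. u t (Z t \<omega>) \<omega> / total_mass (\<lambda>z. u t z \<omega>)) 1 at_top"
    by (rule solution_concentrates[OF assms(5)]) blast
  then show ?thesis by blast
qed

end
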